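(* Let $m\ge5$ and let $R$ be a commutative unital ring. A basis of $H^2(\mathrm{Conf}(|K_m|,2);R)$ is given by the classes represented by the duals of the critical faces in $\mathcal B$. Furthermore, the expression (as a linear combination of basis elements) of the cohomology class represented by the dual of a critical face in $\mathcal C$ is obtained from the following equations $(E_i)$, $1\le i\le 6$, which are congruences modulo the image of $\delta\colon\mu^1(C_m)\to\mu^2(C_m)$: $(E_1)$ for $c>3$: $\displaystyle\sum_x\left[\begin{smallmatrix}x&x&c\\ 2&3&3\end{smallmatrix}\right]-\sum_x\left[\begin{smallmatrix}c&c&x\\ 2&3&3\end{smallmatrix}\right]\equiv\sum_{y\ne3,\ z\in\{1,3\}}\left(\sum_x\left[\begin{smallmatrix}x&x&c\\ z&y&y\end{smallmatrix}\right]-\sum_x\left[\begin{smallmatrix}c&c&x\\ z&y&y\end{smallmatrix}\right]\right)$. $(E_2)$ $\displaystyle\sum_x\left[\begin{smallmatrix}x&x&3\\ 2&4&4\end{smallmatrix}\right]-\sum_x\left[\begin{smallmatrix}3&3&x\\ 2&4&4\end{smallmatrix}\right]\equiv\sum_{y\ne4,\ z\in\{1,4\}}\left(\sum_x\left[\begin{smallmatrix}x&x&3\\ z&y&y\end{smallmatrix}\right]-\sum_x\left[\begin{smallmatrix}3&3&x\\ z&y&y\end{smallmatrix}\right]\right)$. $(E_3)$ for $3\le c\ne d\ge4$ with $(c,d)\ne(3,4)$: $\displaystyle\sum_{x,y}\left[\begin{smallmatrix}x&x&c\\ y&d&d\end{smallmatrix}\right]-\sum_{x,y}\left[\begin{smallmatrix}c&c&x\\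 y&d&d\end{smallmatrix}\right]\equiv\sum_{x,y}\left[\begin{smallmatrix}x&x&c\\ d&y&y\end{smallmatrix}\right]-\sum_{x,y}\left[\begin{smallmatrix}c&c&x\\ d&y&y\end{smallmatrix}\right]$. $(E_4)$ $\displaystyle\sum_{x,y}\left[\begin{smallmatrix}x&x&2\\ y&4&4\end{smallmatrix}\right]-\sum_{(x,y)\ne(3,1)}\left[\begin{smallmatrix}2&2&x\\ y&4&4\end{smallmatrix}\right]\equiv\left(\sum_{x,y}\left[\begin{smallmatrix}x&x&2\\ 4&y&y\end{smallmatrix}\right]-\sum_{x,y}\left[\begin{smallmatrix}2&2&x\\ 4&y&y\end{smallmatrix}\right]\right)-\left(\sum_{x,\ y>4}\left[\begin{smallmatrix}x&x&3\\ 1&y&y\end{smallmatrix}\right]-\sum_{x,y}\left[\begin{smallmatrix}3&3&x\\ 1&y&y\end{smallmatrix}\right]\right)$. $(E_5)$ for $d>4$: $\displaystyle\sum_{x,y}\left[\begin{smallmatrix}x&x&2\\ y&d&d\end{smallmatrix}\right]-\sum_{x,y}\left[\begin{smallmatrix}2&2&x\\ y&d&d\end{smallmatrix}\right]\equiv\sum_{x,y}\left[\begin{smallmatrix}x&x&2\\ d&y&y\end{smallmatrix}\right]-\sum_{x,y}\left[\begin{smallmatrix}2&2&x\\ d&y&y\end{smallmatrix}\right]$. $(E_6)$ for $c>2$: $\displaystyle\sum_{x,y}\left[\begin{smallmatrix}x&x&c\\ 1&y&y\end{smallmatrix}\right]\equiv\sum_{x,y}\left[\begin{smallmatrix}c&c&x\\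 1&y&y\end{smallmatrix}\right]$. Here $c,d<m$, and in all sums the summation variables run over all integers (subject to the indicated restrictions) for which the displayed array is a critical 2-face.
   Context: $\mathrm{Conf}(X,2)=\{(x,y)\in X^2:x\ne y\}$; $|K_m|$ is the complete graph on $V_m=\{1,\ldots,m\}$. The complex $C_m$ (with $|C_m|\simeq\mathrm{Conf}(|K_m|,2)$): vertices are columns $\begin{smallmatrix}a\\ b\end{smallmatrix}$ with $a,b\in V_m$, $a\ne b$; $k$-faces are arrays $\left[\begin{smallmatrix}a_0&\cdots&a_k\\ b_0&\cdots&b_k\end{smallmatrix}\right]$ with weakly increasing rows, $a_j\ne b_j$, consecutive columns distinct, and each row having at most two distinct entries. Faces are oriented by the displayed order of columns. Conditions making a displayed array a face are implicit. $W_m$ is the discrete gradient field on $C_m$ consisting of the following pairings: (a) $\left[\begin{smallmatrix}a&a\\ b&d\end{smallmatrix}\right]\nearrow\left[\begin{smallmatrix}a&a&m\\ b&d&d\end{smallmatrix}\right]$, $a<m>d$; (b) $\left[\begin{smallmatrix}a&a\\ b&m\end{smallmatrix}\right]\nearrow\left[\begin{smallmatrix}a&a&m-1\\ b&m&m\end{smallmatrix}\right]$, $a<m-1$; (c) $\left[\begin{smallmatrix}a&c\\ b&b\end{smallmatrix}\right]\nearrow\left[\begin{smallmatrix}a&c&c\\ b&b&m\end{smallmatrix}\right]$, $b<m>c$; (d) $\left[\begin{smallmatrix}a&m\\ b&b\end{smallmatrix}\right]\nearrow\left[\begin{smallmatrix}a&m&m\\ b&b&m-1\end{smallmatrix}\right]$,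 $b<m-1$; (e) $\left[\begin{smallmatrix}a&c\\ b&d\end{smallmatrix}\right]\nearrow\left[\begin{smallmatrix}a&c&c\\ b&b&d\end{smallmatrix}\right]$, $a<c$, $b<d$, $b\ne c$ and either $c<m>d$ or $c=m>d+1$; (f) $\left[\begin{smallmatrix}a&c\\ b&d\end{smallmatrix}\right]\nearrow\left[\begin{smallmatrix}a&a&c\\ b&d&d\end{smallmatrix}\right]$, $a<c$, $b<d$, $a\ne d$ and either $b=c<m>d$ or $c+1<m=d$; (g) $\left[\begin{smallmatrix}a\\ b\end{smallmatrix}\right]\nearrow\left[\begin{smallmatrix}a&m\\ b&m-1\end{smallmatrix}\right]$, either $b<m-1$ or $a<m-1=b$; (h) $\left[\begin{smallmatrix}a\\ m\end{smallmatrix}\right]\nearrow\left[\begin{smallmatrix}a&m-1\\ m&m\end{smallmatrix}\right]$, $a<m-1$; (i) $\left[\begin{smallmatrix}m-1\\ m\end{smallmatrix}\right]\nearrow\left[\begin{smallmatrix}m-1&m-1\\ m-2&m\end{smallmatrix}\right]$. The critical (unpaired) faces are: the vertex $\left[\begin{smallmatrix}m\\ m-1\end{smallmatrix}\right]$; the 1-faces (k.1) $\left[\begin{smallmatrix}a&m-1\\ b&m\end{smallmatrix}\right]$ with $a=m-1>b+1$ or $a<m-1\ge b$, (k.2) $\left[\begin{smallmatrix}m&m\\ b&d\end{smallmatrix}\right]$ with $d<m-1$, (k.3) $\left[\begin{smallmatrix}a&c\\ m&m\end{smallmatrix}\right]$ with $c<m-1$; the 2-faces $\left[\begin{smallmatrix}a&a&c\\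 b&d&d\end{smallmatrix}\right]$ with $b\ne c<m>d$, i.e. with $1\le a<c<m$, $1\le b<d<m$ and $c\ne d\ne a\ne b\ne c$. Morse cochain complex: $\mu^p(C_m)$ is the free $R$-module on (duals of) critical $p$-faces (duals are denoted by the same symbols as the faces). For a codimension-one face $\alpha\subset\beta$ let $\iota_{\alpha,\beta}=\pm1$ be the coefficient of $\alpha$ in $\partial\beta$, where $\partial[v_0,\ldots,v_i]=\sum_j(-1)^j[v_0,\ldots,\widehat{v_j},\ldots,v_i]$. Then $\delta(\alpha)=\sum_\beta\left(\sum_{\lambda}\mu(\lambda)\right)\beta$, where $\beta$ runs over critical $(p+1)$-faces and $\lambda$ over mixed paths $\beta\searrow\alpha_0\nearrow\beta_1\searrow\alpha_1\nearrow\cdots\nearrow\beta_k\searrow\alpha_k=\alpha$ ($k\ge0$; each $\alpha_{j-1}\nearrow\beta_j$ in $W_m$, each $\searrow$ passes to a codimension-one face by an inclusion not in $W_m$), with $\mu(\lambda)=\iota_{\alpha_0,\beta}\prod_{j=1}^k(-\iota_{\alpha_{j-1},\beta_j}\iota_{\alpha_j,\beta_j})$. The cohomology of $(\mu^*(C_m),\delta)$ is canonically $H^*(\mathrm{Conf}(|K_m|,2);R)$; in particular $H^2(\mathrm{Conf}(|K_m|,2);R)$ is the cokernel of $\delta\colon\mu^1(C_m)\to\mu^2(C_m)$. $\mathcal C$ is the collection of critical 2-faces of one of the four types: $\left[\begin{smallmatrix}1&1&c\\ 2&d&d\end{smallmatrix}\right]$ with $c,d\in\{3,\ldots,m-1\}$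 (and $c\neq d$); $\left[\begin{smallmatrix}1&1&2\\ 3&d&d\end{smallmatrix}\right]$ with $d\in\{4,\ldots,m-1\}$; $\left[\begin{smallmatrix}2&2&c\\ 1&3&3\end{smallmatrix}\right]$ with $c\in\{4,\ldots,m-1\}$; $\left[\begin{smallmatrix}2&2&3\\ 1&4&4\end{smallmatrix}\right]$. $\mathcal B$ is the collection of all other critical 2-faces. *)

theory Defs
  imports Complex_Main "HOL-Library.FuncSet" "HOL-Library.Function_Algebras"
begin

text \<open>The complex \<open>C\<^sub>m\<close>: an array with rows \<open>as\<close>, \<open>bs\<close> is the list \<open>zip as bs\<close> of its
  columns. Since the rows increase weakly and consecutive columns differ, a face is determined by its set of columns, and its
  orientation is the order of the list.\<close>

type_synonym face = "(nat \<times> nat) list"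

definition is_face :: "nat \<Rightarrow> face \<Rightarrow> bool" where
  "is_face m F \<longleftrightarrow>
     F \<noteq> [] \<and>
     (\<forall>(a, b) \<in> set F. a \<in> {1..m} \<and> b \<in> {1..m} \<and> a \<noteq> b) \<and>
     sorted (map fst F) \<and> sorted (map snd F) \<and>
     (\<forall>j. Suc j < length F \<longrightarrow> F ! j \<noteq> F ! Suc j) \<and>
     card (set (map fst F)) \<le> 2 \<and> card (set (map snd F)) \<le> 2"

definition faces :: "nat \<Rightarrow> nat \<Rightarrow> face set" where
  "faces m k = {F. is_face m F \<and> length F = Suc k}"

definition del :: "nat \<Rightarrow> face \<Rightarrow> face" where
  "del j F = take j F @ drop (Suc j) F"

definition facet :: "nat \<Rightarrow> face \<Rightarrow> face \<Rightarrow> bool" where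
  "facet m \<alpha> \<beta> \<longleftrightarrow> is_face m \<alpha> \<and> is_face m \<beta> \<and> (\<exists>j < length \<beta>. \<alpha> = del j \<beta>)"

text \<open>The coefficient of \<open>\<alpha>\<close> in \<open>\<partial>\<beta>\<close>; the sum has at most one term when \<open>\<beta>\<close> is a face.\<close>

definition incidence :: "face \<Rightarrow> face \<Rightarrow> int" where
  "incidence \<alpha> \<beta> = (\<Sum>j | j < length \<beta> \<and> del j \<beta> = \<alpha>. (-1) ^ j)"

text \<open>Clauses (a)--(i) of \<open>W\<^sub>m\<close>. The implicit requirement that both arrays be faces is imposed in \<open>W\<close> below.\<close>

inductive pairing :: "nat \<Rightarrow> face \<Rightarrow> face \<Rightarrow> bool" for m :: nat where
  a: "a < m \<Longrightarrow> d < m \<Longrightarrow>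
      pairing m (zip [a, a] [b, d]) (zip [a, a, m] [b, d, d])"
| b: "a < m - 1 \<Longrightarrow>
      pairing m (zip [a, a] [b, m]) (zip [a, a, m - 1] [b, m, m])"
| c: "b < m \<Longrightarrow> c < m \<Longrightarrow>
      pairing m (zip [a, c] [b, b]) (zip [a, c, c] [b, b, m])"
| d: "b < m - 1 \<Longrightarrow>
      pairing m (zip [a, m] [b, b]) (zip [a, m, m] [b, b, m - 1])"
| e: "a < c \<Longrightarrow> b < d \<Longrightarrow> b \<noteq> c \<Longrightarrow> (c < m \<and> d < m) \<or> (c = m \<and> d + 1 < m) \<Longrightarrow>
      pairing m (zip [a, c] [b, d]) (zip [a, c, c] [b, b, d])"
| f: "a < c \<Longrightarrow> b < d \<Longrightarrow> a \<noteq> d \<Longrightarrow> (b = c \<and> c < m \<and> d < m) \<or> (c + 1 < m \<and> d = m) \<Longrightarrow>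
      pairing m (zip [a, c] [b, d]) (zip [a, a, c] [b, d, d])"
| g: "b < m - 1 \<or> (a < m - 1 \<and> b = m - 1) \<Longrightarrow>
      pairing m (zip [a] [b]) (zip [a, m] [b, m - 1])"
| h: "a < m - 1 \<Longrightarrow>
      pairing m (zip [a] [m]) (zip [a, m - 1] [m, m])"
| i: "pairing m (zip [m - 1] [m]) (zip [m - 1, m - 1] [m - 2, m])"

definition W :: "nat \<Rightarrow> face \<Rightarrow> face \<Rightarrow> bool" where
  "W m \<alpha> \<beta> \<longleftrightarrow> is_face m \<alpha> \<and> is_face m \<beta> \<and> pairing m \<alpha> \<beta>"

definition critical :: "nat \<Rightarrow> nat \<Rightarrow> face set" where
  "critical m k = {F \<in> faces m k. \<not> (\<exists>G. W m F G \<or> W m G F)}"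

text \<open>The mixed path
  \<open>\<beta>\<^sub>0 \<searrow> \<alpha>\<^sub>0 \<nearrow> \<beta>\<^sub>1 \<searrow> \<alpha>\<^sub>1 \<nearrow> \<dots> \<nearrow> \<beta>\<^sub>k \<searrow> \<alpha>\<^sub>k\<close> is encoded as the list
  \<open>[(\<beta>\<^sub>0, \<alpha>\<^sub>0), (\<beta>\<^sub>1, \<alpha>\<^sub>1), \<dots>, (\<beta>\<^sub>k, \<alpha>\<^sub>k)]\<close> of its downward steps.\<close>

definition mixed_paths :: "nat \<Rightarrow> face \<Rightarrow> face \<Rightarrow> (face \<times> face) list set" where
  "mixed_paths m \<beta> \<alpha> =
     {p. p \<noteq> [] \<and> fst (hd p) = \<beta> \<and> snd (last p) = \<alpha> \<and>
         (\<forall>(\<beta>', \<alpha>') \<in> set p. facet m \<alpha>' \<beta>' \<and> \<not> W m \<alpha>' \<beta>') \<and>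
         (\<forall>j. Suc j < length p \<longrightarrow> W m (snd (p ! j)) (fst (p ! Suc j)))}"

definition multiplicity :: "(face \<times> face) list \<Rightarrow> int" where
  "multiplicity p =
     incidence (snd (p ! 0)) (fst (p ! 0)) *
     (\<Prod>j = 1..<length p.
        - (incidence (snd (p ! (j - 1))) (fst (p ! j)) * incidence (snd (p ! j)) (fst (p ! j))))"

text \<open>Cochains are coefficient functions on faces: the free module on the critical \<open>p\<close>-faces
  consists of the functions vanishing off them. As \<open>C\<^sub>m\<close> is finite, finiteness of the support
  is automatic.\<close>

definition cochains :: "nat \<Rightarrow> nat \<Rightarrow> (face \<Rightarrow> 'r::comm_ring_1) set" where
  "cochains m p = {f. \<forall>F. F \<notin> critical m p \<longrightarrow> f F = 0}"

definition scale :: "'r::comm_ring_1 \<Rightarrow> (face \<Rightarrow> 'r) \<Rightarrow> face \<Rightarrow> 'r" where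
  "scale r f = (\<lambda>F. r * f F)"

interpretation cochain: module scale
  by unfold_locales (auto simp: scale_def fun_eq_iff algebra_simps)

definition dual :: "face \<Rightarrow> face \<Rightarrow> 'r::comm_ring_1" where
  "dual \<beta> = (\<lambda>F. if F = \<beta> then 1 else 0)"

text \<open>The linear extension of
  \<open>\<alpha> \<mapsto> \<Sum>\<^sub>\<beta> (\<Sum>\<^sub>\<lambda> \<mu>(\<lambda>)) \<beta>\<close>.\<close>

definition coboundary :: "nat \<Rightarrow> nat \<Rightarrow> (face \<Rightarrow> 'r::comm_ring_1) \<Rightarrow> face \<Rightarrow> 'r" where
  "coboundary m k f =
     (\<Sum>\<alpha> \<in> critical m k. scale (f \<alpha>)
        (\<Sum>\<beta> \<in> critical m (Suc k).
           scale (of_int (\<Sum>p \<in> mixed_paths m \<beta> \<alpha>. multiplicity p)) (dual \<beta>)))"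

text \<open>\<open>H\<^sup>2(Conf(|K\<^sub>m|, 2); R)\<close> as the cokernel of
  \<open>\<delta> : \<mu>\<^sup>1(C\<^sub>m) \<rightarrow> \<mu>\<^sup>2(C\<^sub>m)\<close>. Its elements are the classes of \<open>cong_rel m\<close>, with the module
  operations induced from representatives.\<close>

definition cong_rel :: "nat \<Rightarrow> ((face \<Rightarrow> 'r::comm_ring_1) \<times> (face \<Rightarrow> 'r)) set" where
  "cong_rel m =
     {(f, g). f \<in> cochains m 2 \<and> g \<in> cochains m 2 \<and> f - g \<in> coboundary m 1 ` cochains m 1}"

definition H2 :: "nat \<Rightarrow> (face \<Rightarrow> 'r::comm_ring_1) set set" where
  "H2 m = cochains m 2 // cong_rel m"

definition cohomology_class :: "nat \<Rightarrow> (face \<Rightarrow> 'r::comm_ring_1) \<Rightarrow> (face \<Rightarrow> 'r) set" where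
  "cohomology_class m f = cong_rel m `` {f}"

definition setC :: "nat \<Rightarrow> face set" where
  "setC m = critical m 2 \<inter>
     ({zip [1, 1, c] [2, d, d] | c d. c \<in> {3..m - 1} \<and> d \<in> {3..m - 1} \<and> c \<noteq> d} \<union>
      {zip [1, 1, 2] [3, d, d] | d. d \<in> {4..m - 1}} \<union>
      {zip [2, 2, c] [1, 3, 3] | c. c \<in> {4..m - 1}} \<union>
      {zip [2, 2, 3] [1, 4, 4]})"

definition setB :: "nat \<Rightarrow> face set" where
  "setB m = critical m 2 - setC m"

definition lincombB :: "nat \<Rightarrow> (face \<Rightarrow> 'r::comm_ring_1) \<Rightarrow> face \<Rightarrow> 'r" where
  "lincombB m s = (\<Sum>\<beta> \<in> setB m. scale (s \<beta>) (dual \<beta>))"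

text \<open>\<open>equation m l r\<close>: the congruence \<open>l \<equiv> r\<close> is one of \<open>(E\<^sub>1)\<close>--\<open>(E\<^sub>6)\<close>. The inner and outer
  summations on the right of \<open>(E\<^sub>1)\<close>, \<open>(E\<^sub>2)\<close> are merged. All index sets are finite because the
  entries of a critical face lie in \<open>{1..m}\<close>.\<close>

inductive equation :: "nat \<Rightarrow> (face \<Rightarrow> 'r::comm_ring_1) \<Rightarrow> (face \<Rightarrow> 'r) \<Rightarrow> bool" for m :: nat where
  E1: "3 < c \<Longrightarrow> c < m \<Longrightarrow> equation m
     ((\<Sum>x | zip [x, x, c] [2, 3, 3] \<in> critical m 2. dual (zip [x, x, c] [2, 3, 3]))
      - (\<Sum>x | zip [c, c, x] [2, 3, 3] \<in> critical m 2. dual (zip [c, c, x] [2, 3, 3])))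
     ((\<Sum>(x, y, z) | y \<noteq> 3 \<and> z \<in> {1, 3} \<and> zip [x, x, c] [z, y, y] \<in> critical m 2.
          dual (zip [x, x, c] [z, y, y]))
      - (\<Sum>(x, y, z) | y \<noteq> 3 \<and> z \<in> {1, 3} \<and> zip [c, c, x] [z, y, y] \<in> critical m 2.
          dual (zip [c, c, x] [z, y, y])))"
| E2: "equation m
     ((\<Sum>x | zip [x, x, 3] [2, 4, 4] \<in> critical m 2. dual (zip [x, x, 3] [2, 4, 4]))
      - (\<Sum>x | zip [3, 3, x] [2, 4, 4] \<in> critical m 2. dual (zip [3, 3, x] [2, 4, 4])))
     ((\<Sum>(x, y, z) | y \<noteq> 4 \<and> z \<in> {1, 4} \<and> zip [x, x, 3] [z, y, y] \<in> critical m 2.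
          dual (zip [x, x, 3] [z, y, y]))
      - (\<Sum>(x, y, z) | y \<noteq> 4 \<and> z \<in> {1, 4} \<and> zip [3, 3, x] [z, y, y] \<in> critical m 2.
          dual (zip [3, 3, x] [z, y, y])))"
| E3: "3 \<le> c \<Longrightarrow> c \<noteq> d \<Longrightarrow> 4 \<le> d \<Longrightarrow> (c, d) \<noteq> (3, 4) \<Longrightarrow> c < m \<Longrightarrow> d < m \<Longrightarrow> equation m
     ((\<Sum>(x, y) | zip [x, x, c] [y, d, d] \<in> critical m 2. dual (zip [x, x, c] [y, d, d]))
      - (\<Sum>(x, y) | zip [c, c, x] [y, d, d] \<in> critical m 2. dual (zip [c, c, x] [y, d, d])))
     ((\<Sum>(x, y) | zip [x, x, c] [d, y, y] \<in> critical m 2. dual (zip [x, x, c] [d, y, y]))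
      - (\<Sum>(x, y) | zip [c, c, x] [d, y, y] \<in> critical m 2. dual (zip [c, c, x] [d, y, y])))"
| E4: "equation m
     ((\<Sum>(x, y) | zip [x, x, 2] [y, 4, 4] \<in> critical m 2. dual (zip [x, x, 2] [y, 4, 4]))
      - (\<Sum>(x, y) | (x, y) \<noteq> (3, 1) \<and> zip [2, 2, x] [y, 4, 4] \<in> critical m 2.
          dual (zip [2, 2, x] [y, 4, 4])))
     (((\<Sum>(x, y) | zip [x, x, 2] [4, y, y] \<in> critical m 2. dual (zip [x, x, 2] [4, y, y]))
       - (\<Sum>(x, y) | zip [2, 2, x] [4, y, y] \<in> critical m 2. dual (zip [2, 2, x] [4, y, y])))
      - ((\<Sum>(x, y) | 4 < y \<and> zip [x, x, 3] [1, y, y] \<in> critical m 2.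
            dual (zip [x, x, 3] [1, y, y]))
         - (\<Sum>(x, y) | zip [3, 3, x] [1, y, y] \<in> critical m 2. dual (zip [3, 3, x] [1, y, y]))))"
| E5: "4 < d \<Longrightarrow> d < m \<Longrightarrow> equation m
     ((\<Sum>(x, y) | zip [x, x, 2] [y, d, d] \<in> critical m 2. dual (zip [x, x, 2] [y, d, d]))
      - (\<Sum>(x, y) | zip [2, 2, x] [y, d, d] \<in> critical m 2. dual (zip [2, 2, x] [y, d, d])))
     ((\<Sum>(x, y) | zip [x, x, 2] [d, y, y] \<in> critical m 2. dual (zip [x, x, 2] [d, y, y]))
      - (\<Sum>(x, y) | zip [2, 2, x] [d, y, y] \<in> critical m 2. dual (zip [2, 2, x] [d, y, y])))"
| E6: "2 < c \<Longrightarrow> c < m \<Longrightarrow> equation m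
     (\<Sum>(x, y) | zip [x, x, c] [1, y, y] \<in> critical m 2. dual (zip [x, x, c] [1, y, y]))
     (\<Sum>(x, y) | zip [c, c, x] [1, y, y] \<in> critical m 2. dual (zip [c, c, x] [1, y, y]))"

end

theory Submission
  imports Defs
begin

text \<open>
  A critical triangle has columns \<open>(a, b)\<close>, \<open>(a, d)\<close>, \<open>(c, d)\<close> with \<open>a < c < m\<close>, \<open>b < d < m\<close>
  and \<open>{a, c}\<close> disjoint from \<open>{b, d}\<close>. It is a rectangle in the square grid \<open>{1..<m} \<times> {1..<m}\<close>
  that avoids the diagonal. Its diagonal edge is paired with the other triangle of the same
  rectangle, so mixed paths go on through the four sides (the first coordinate is drawn
  horizontally). A vertical side leads to at most one critical edge, with columns \<open>(m, b)\<close>,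
  \<open>(m, d)\<close>, and the two vertical sides have opposite signs. The horizontal sides also contribute
  with opposite signs to the edge \<open>(a, m)\<close>, \<open>(c, m)\<close>, so this edge cancels as well. Their other
  paths, one for each corner \<open>(p, q)\<close>, survive and end in the edge with columns \<open>(p, q)\<close>,
  \<open>(m - 1, m)\<close>. Thus a critical 1-cochain acts only through the matrix \<open>g\<close> of its values at
  these edges, and the coboundary is the mixed second difference \<open>g a d - g c d - g a b + g c b\<close>
  (\<open>coboundary_eq_cross\<close>). The edge at the corner \<open>(m - 1, m - 2)\<close> is paired and carries no
  cochain, but constants have no second difference, so every matrix occurs (\<open>image_coboundary\<close>).

  A second difference does not see functions of \<open>p\<close> alone or of \<open>q\<close> alone in \<open>g p q\<close>.
  Subtracting such functions makes \<open>g\<close> vanish for \<open>p = 1\<close>, for \<open>q = 2\<close> and at \<open>(2, 1)\<close>, \<open>(2, 3)\<close>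
  (\<open>normalise\<close>). The other off-diagonal entries correspond one to one to the rectangles in
  \<open>setC m\<close>: taken in the order \<open>[(1, 2), (1, d), (c, d)]\<close>, \<open>[(1, 3), (1, d), (2, d)]\<close>,
  \<open>[(2, 1), (2, 3), (c, 3)]\<close>, \<open>[(2, 1), (2, 4), (3, 4)]\<close>, each rectangle has exactly one corner
  that is neither normalised to zero nor already a corner of an earlier one, and its entry has
  coefficient \<open>1\<close> or \<open>-1\<close>. This triangular system is solvable and has a unique solution over
  every ring, so the values of a coboundary on \<open>setC m\<close> can be prescribed and determine the
  coboundary (\<open>prescribe_on_C\<close>, \<open>normalised_cross_eq_0\<close>). Hence every 2-cochain is congruent to
  exactly one that is supported on \<open>setB m\<close>.

  The difference of the two sides of each of the six congruences is the second difference of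
  one or two matrix units with signs. These combinations are again triangular in the matrix
  units at the entries that normalisation leaves free, so they span all second differences
  (\<open>normalised_in_span\<close>), and the congruences suffice to express \<open>setC m\<close> through \<open>setB m\<close>.
\<close>

section \<open>Faces, edges and triangles\<close>

text \<open>The first coordinates come before the second ones, as in the two-row display of a face.\<close>

abbreviation rect :: "nat \<Rightarrow> nat \<Rightarrow> nat \<Rightarrow> nat \<Rightarrow> face" where
  "rect a c b d \<equiv> [(a, b), (a, d), (c, d)]"

lemma card_pair_le: "card {x, y} \<le> 2"
  by (simp add: card_insert_if)

lemma card_triple_le: "card {x, y, z} \<le> 2 \<longleftrightarrow> x = y \<or> x = z \<or> y = z"
  by (simp add: card_insert_if)

lemma is_face_edge:
  "is_face m [(a, b), (c, d)] \<longleftrightarrow>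
     1 \<le> a \<and> a \<le> c \<and> c \<le> m \<and> 1 \<le> b \<and> b \<le> d \<and> d \<le> m \<and> a \<noteq> b \<and> c \<noteq> d \<and> (a, b) \<noteq> (c, d)"
  using card_pair_le[of a c] card_pair_le[of b d]
  by (simp add: is_face_def All_less_Suc) auto

text \<open>A triangle follows a staircase around a rectangle of the grid, first up and then right
  or first right and then up: with three columns, two distinct entries in each row leave room
  for only one step in each coordinate.\<close>

lemma is_face_triangle:
  "is_face m [(a, b), (c, d), (e, f)] \<longleftrightarrow>
     1 \<le> a \<and> e \<le> m \<and> 1 \<le> b \<and> f \<le> m \<and> a \<noteq> b \<and> c \<noteq> d \<and> e \<noteq> f \<and>
     ((a = c \<and> c < e \<and> b < d \<and> d = f) \<or> (a < c \<and> c = e \<and> b = d \<and> d < f))"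
  unfolding is_face_def
  apply (simp add: card_triple_le All_less_Suc)
  apply (cases "a = c"; cases "c = e"; cases "b = d"; cases "d = f"; simp)
  apply auto
  done

lemma is_face_vertex: "is_face m [(a, b)] \<longleftrightarrow> 1 \<le> a \<and> a \<le> m \<and> 1 \<le> b \<and> b \<le> m \<and> a \<noteq> b"
  by (auto simp: is_face_def)

lemmas is_face_short = is_face_vertex is_face_edge is_face_triangle

section \<open>The gradient field is a matching\<close>

text \<open>Clauses (a)--(i) can only assign one coface to each face, so they define a partial
  function of the lower face.\<close>

fun upper_partner :: "nat \<Rightarrow> face \<Rightarrow> face" where
  "upper_partner m [(a, b)] =
     (if b < m then [(a, b), (m, m - 1)] else if a < m - 1 then [(a, m), (m - 1, m)]
      else [(m - 1, m - 2), (m - 1, m)])"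
| "upper_partner m [(a, b), (c, d)] =
     (if a = c then [(a, b), (a, d), if d < m then (m, d) else (m - 1, m)]
      else if b = d then [(a, b), (c, b), if c < m then (c, m) else (m, m - 1)]
      else if (c < m \<and> d < m \<and> b \<noteq> c) \<or> (c = m \<and> d + 1 < m) then [(a, b), (c, b), (c, d)]
      else [(a, b), (a, d), (c, d)])"
| "upper_partner m _ = []"

lemma W_upper_partner: "W m \<alpha> \<beta> \<Longrightarrow> \<beta> = upper_partner m \<alpha>"
  unfolding W_def
  by (elim conjE, erule pairing.cases;
      (simp add: is_face_short; fail)?; elim disjE conjE; simp add: is_face_short)

text \<open>The pairing is injective: the upper face determines the lower one. For a triangle, its
  shape and its last column decide between the diagonal edge and the first side.\<close>

fun lower_partner :: "nat \<Rightarrow> face \<Rightarrow> face" where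
  "lower_partner m [(a, b), (c, d)] = (if a = m - 1 \<and> c = m - 1 then [(m - 1, m)] else [(a, b)])"
| "lower_partner m [(a, b), (c, d), (e, f)] =
     (if a = c then if e = m \<or> f = m \<and> e = m - 1 then [(a, b), (c, d)] else [(a, b), (e, f)]
      else if f = m \<or> e = m \<and> f = m - 1 then [(a, b), (c, d)] else [(a, b), (e, f)])"
| "lower_partner m _ = []"

lemma W_lower_partner: "W m \<alpha> \<beta> \<Longrightarrow> \<alpha> = lower_partner m \<beta>"
  unfolding W_def
  by (elim conjE, erule pairing.cases;
      (simp add: is_face_short; fail)?; elim disjE conjE; simp add: is_face_short)

text \<open>Mixed paths stop at these edges. Every edge that is paired with a vertex is among them,
  and so is every critical edge at a corner of a rectangle.\<close>

lemma W_last_column: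
  assumes "W m [x, y] \<beta>"
  shows "y \<noteq> (m, m - 1)" and "y \<noteq> (m - 1, m)"
proof -
  have f: "is_face m [x, y]" and p: "pairing m [x, y] \<beta>"
    using assms by (auto simp: W_def)
  from p f show "y \<noteq> (m, m - 1)"
    by (cases; (simp add: is_face_short; fail)?; elim disjE conjE; simp add: is_face_short)
  from p f show "y \<noteq> (m - 1, m)"
    by (cases; (simp add: is_face_short; fail)?; elim disjE conjE; simp add: is_face_short)
qed

section \<open>Sums over mixed paths\<close>

text \<open>The part of a mixed path after its first downward step. Such parts have their own
  recursion: a path from \<open>\<alpha>\<^sub>0\<close> ends there, or climbs to the partner of \<open>\<alpha>\<^sub>0\<close> and leaves it
  through another facet.\<close>

fun trail :: "nat \<Rightarrow> face \<Rightarrow> face \<Rightarrow> (face \<times> face) list \<Rightarrow> bool" where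
  "trail m \<alpha>\<^sub>0 \<alpha> [] \<longleftrightarrow> \<alpha>\<^sub>0 = \<alpha>"
| "trail m \<alpha>\<^sub>0 \<alpha> ((\<beta>, \<alpha>\<^sub>1) # p) \<longleftrightarrow>
     W m \<alpha>\<^sub>0 \<beta> \<and> facet m \<alpha>\<^sub>1 \<beta> \<and> \<not> W m \<alpha>\<^sub>1 \<beta> \<and> trail m \<alpha>\<^sub>1 \<alpha> p"

fun weight :: "face \<Rightarrow> (face \<times> face) list \<Rightarrow> int" where
  "weight \<alpha>\<^sub>0 [] = 1"
| "weight \<alpha>\<^sub>0 ((\<beta>, \<alpha>\<^sub>1) # p) = - (incidence \<alpha>\<^sub>0 \<beta> * incidence \<alpha>\<^sub>1 \<beta>) * weight \<alpha>\<^sub>1 p"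

lemma multiplicity_Cons: "multiplicity ((\<beta>, \<alpha>\<^sub>0) # p) = incidence \<alpha>\<^sub>0 \<beta> * weight \<alpha>\<^sub>0 p"
proof -
  let ?r = "\<lambda>q j. - (incidence (snd (q ! (j - 1))) (fst (q ! j)) * incidence (snd (q ! j)) (fst (q ! j)))"
  have "(\<Prod>j = 1..<length ((\<beta>, \<alpha>\<^sub>0) # p). ?r ((\<beta>, \<alpha>\<^sub>0) # p) j) = weight \<alpha>\<^sub>0 p"
  proof (induction p arbitrary: \<beta> \<alpha>\<^sub>0)
    case (Cons s p)
    obtain \<beta>\<^sub>1 \<alpha>\<^sub>1 where s: "s = (\<beta>\<^sub>1, \<alpha>\<^sub>1)" by fastforce
    let ?q = "(\<beta>, \<alpha>\<^sub>0) # s # p"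
    have "(\<Prod>j = 1..<length ?q. ?r ?q j) = ?r ?q 1 * (\<Prod>j = Suc 1..<length ?q. ?r ?q j)"
      by (subst prod.atLeast_Suc_lessThan) auto
    also have "(\<Prod>j = Suc 1..<length ?q. ?r ?q j) = (\<Prod>j = 1..<length (s # p). ?r ?q (Suc j))"
      using prod.shift_bounds_Suc_ivl[of "?r ?q" 1 "length (s # p)"] by simp
    also have "\<dots> = (\<Prod>j = 1..<length (s # p). ?r (s # p) j)"
      by (intro prod.cong) (auto simp: nth_Cons' )
    finally show ?case using Cons.IH[of \<beta>\<^sub>1 \<alpha>\<^sub>1] by (simp add: s)
  qed simp
  then show ?thesis by (simp add: multiplicity_def)
qed

lemma all_nat_split: "(\<forall>j. P j) \<longleftrightarrow> P 0 \<and> (\<forall>j. P (Suc j))"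
  by (metis not0_implies_Suc)

lemma mixed_path_Cons:
  "(\<beta>, \<alpha>\<^sub>0) # p \<in> mixed_paths m \<beta>' \<alpha> \<longleftrightarrow>
     \<beta> = \<beta>' \<and> facet m \<alpha>\<^sub>0 \<beta> \<and> \<not> W m \<alpha>\<^sub>0 \<beta> \<and> trail m \<alpha>\<^sub>0 \<alpha> p"
proof (induction p arbitrary: \<beta> \<beta>' \<alpha>\<^sub>0)
  case Nil
  then show ?case by (auto simp: mixed_paths_def)
next
  case (Cons s p)
  obtain \<beta>\<^sub>1 \<alpha>\<^sub>1 where s: "s = (\<beta>\<^sub>1, \<alpha>\<^sub>1)" by fastforce
  have "(\<beta>, \<alpha>\<^sub>0) # s # p \<in> mixed_paths m \<beta>' \<alpha> \<longleftrightarrow>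
     \<beta> = \<beta>' \<and> facet m \<alpha>\<^sub>0 \<beta> \<and> \<not> W m \<alpha>\<^sub>0 \<beta> \<and> W m \<alpha>\<^sub>0 \<beta>\<^sub>1 \<and> s # p \<in> mixed_paths m \<beta>\<^sub>1 \<alpha>"
    unfolding mixed_paths_def mem_Collect_eq
    by (subst all_nat_split) (auto simp: s)
  with Cons.IH[of \<beta>\<^sub>1 \<alpha>\<^sub>1 \<beta>\<^sub>1] show ?case by (auto simp: s)
qed

text \<open>Finiteness belongs to the definition, because a sum over infinitely many paths would be
  \<open>0\<close> by convention and the recursion would fail for it.\<close>

definition flow :: "nat \<Rightarrow> face \<Rightarrow> face \<Rightarrow> int \<Rightarrow> bool" where
  "flow m \<alpha>\<^sub>0 \<alpha> n \<longleftrightarrow> finite {p. trail m \<alpha>\<^sub>0 \<alpha> p} \<and> (\<Sum>p | trail m \<alpha>\<^sub>0 \<alpha> p. weight \<alpha>\<^sub>0 p) = n"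

lemma trail_stop: "(\<And>\<beta>. \<not> W m \<alpha>\<^sub>0 \<beta>) \<Longrightarrow> trail m \<alpha>\<^sub>0 \<alpha> p \<longleftrightarrow> p = [] \<and> \<alpha>\<^sub>0 = \<alpha>"
  by (cases p) auto

lemma flow_stop:
  assumes "\<And>\<beta>. \<not> W m \<alpha>\<^sub>0 \<beta>"
  shows "flow m \<alpha>\<^sub>0 \<alpha> (of_bool (\<alpha>\<^sub>0 = \<alpha>))"
  unfolding flow_def trail_stop[OF assms] by (cases "\<alpha>\<^sub>0 = \<alpha>") simp_all

text \<open>Both a whole mixed path and its part after an upward step split by the facet through
  which the next triangle is left. The factor \<open>k\<close> covers the two sign conventions.\<close>

lemma sum_over_first_step:
  fixes w :: "(face \<times> face) list \<Rightarrow> int"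
  assumes "finite A"
    and "\<And>\<alpha>'. \<alpha>' \<in> A \<Longrightarrow> flow m \<alpha>' \<alpha> (n \<alpha>')"
    and "\<And>\<alpha>' p. w ((\<beta>, \<alpha>') # p) = k \<alpha>' * weight \<alpha>' p"
    and "S = (\<Union>\<alpha>' \<in> A. Cons (\<beta>, \<alpha>') ` {p. trail m \<alpha>' \<alpha> p})"
  shows "finite S" and "sum w S = (\<Sum>\<alpha>' \<in> A. k \<alpha>' * n \<alpha>')"
proof -
  have fin: "\<And>\<alpha>'. \<alpha>' \<in> A \<Longrightarrow> finite {p. trail m \<alpha>' \<alpha> p}"
    and n: "\<And>\<alpha>'. \<alpha>' \<in> A \<Longrightarrow> (\<Sum>p | trail m \<alpha>' \<alpha> p. weight \<alpha>' p) = n \<alpha>'"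
    using assms(2) by (auto simp: flow_def)
  show "finite S" using assms(1) fin by (simp add: assms(4))
  have "sum w S = (\<Sum>\<alpha>' \<in> A. sum w (Cons (\<beta>, \<alpha>') ` {p. trail m \<alpha>' \<alpha> p}))"
    unfolding assms(4) by (rule sum.UNION_disjoint) (use assms(1) fin in auto)
  also have "\<dots> = (\<Sum>\<alpha>' \<in> A. k \<alpha>' * n \<alpha>')"
    by (intro sum.cong refl) (simp add: sum.reindex assms(3) n flip: sum_distrib_left)
  finally show "sum w S = (\<Sum>\<alpha>' \<in> A. k \<alpha>' * n \<alpha>')" .
qed

lemma flow_up:
  assumes W: "W m \<alpha>\<^sub>0 \<beta>" and "\<alpha>\<^sub>0 \<noteq> \<alpha>" and A: "finite A" "A = {\<alpha>'. facet m \<alpha>' \<beta> \<and> \<not> W m \<alpha>' \<beta>}"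
    and flow: "\<And>\<alpha>'. \<alpha>' \<in> A \<Longrightarrow> flow m \<alpha>' \<alpha> (n \<alpha>')"
  shows "flow m \<alpha>\<^sub>0 \<alpha> (\<Sum>\<alpha>' \<in> A. - (incidence \<alpha>\<^sub>0 \<beta> * incidence \<alpha>' \<beta>) * n \<alpha>')"
proof -
  have "trail m \<alpha>\<^sub>0 \<alpha> p \<longleftrightarrow> p \<in> (\<Union>\<alpha>' \<in> A. Cons (\<beta>, \<alpha>') ` {p. trail m \<alpha>' \<alpha> p})" for p
  proof (cases p)
    case (Cons s q)
    then show ?thesis
      using W W_upper_partner[OF W] W_upper_partner[of m \<alpha>\<^sub>0 "fst s"] by (cases s) (auto simp: A)
  qed (use \<open>\<alpha>\<^sub>0 \<noteq> \<alpha>\<close> in auto)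
  then have S: "{p. trail m \<alpha>\<^sub>0 \<alpha> p} = (\<Union>\<alpha>' \<in> A. Cons (\<beta>, \<alpha>') ` {p. trail m \<alpha>' \<alpha> p})"
    by blast
  show ?thesis
    unfolding flow_def
    using sum_over_first_step[OF A(1) flow _ S, where w = "weight \<alpha>\<^sub>0"
        and k = "\<lambda>\<alpha>'. - (incidence \<alpha>\<^sub>0 \<beta> * incidence \<alpha>' \<beta>)"] by simp
qed

lemma path_sum:
  assumes A: "finite A" "A = {\<alpha>'. facet m \<alpha>' \<beta> \<and> \<not> W m \<alpha>' \<beta>}"
    and flow: "\<And>\<alpha>'. \<alpha>' \<in> A \<Longrightarrow> flow m \<alpha>' \<alpha> (n \<alpha>')"
  shows "(\<Sum>p \<in> mixed_paths m \<beta> \<alpha>. multiplicity p) = (\<Sum>\<alpha>' \<in> A. incidence \<alpha>' \<beta> * n \<alpha>')"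
proof -
  have "p \<in> mixed_paths m \<beta> \<alpha> \<longleftrightarrow> p \<in> (\<Union>\<alpha>' \<in> A. Cons (\<beta>, \<alpha>') ` {p. trail m \<alpha>' \<alpha> p})" for p
  proof (cases p)
    case (Cons s q)
    then show ?thesis by (cases s) (auto simp: A mixed_path_Cons)
  qed (auto simp: mixed_paths_def)
  then have S: "mixed_paths m \<beta> \<alpha> = (\<Union>\<alpha>' \<in> A. Cons (\<beta>, \<alpha>') ` {p. trail m \<alpha>' \<alpha> p})"
    by blast
  show ?thesis
    using sum_over_first_step(2)[OF A(1) flow multiplicity_Cons S] by simp
qed

lemma facet_triangle:
  assumes "is_face m [x, y, z]"
  shows "facet m \<alpha> [x, y, z] \<longleftrightarrow> \<alpha> \<in> {[y, z], [x, z], [x, y]}"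
proof -
  have "is_face m [y, z] \<and> is_face m [x, z] \<and> is_face m [x, y]"
    using assms
    by (cases x; cases y; cases z) (simp only: is_face_short; elim conjE disjE; simp)
  moreover have "(\<exists>j<length [x, y, z]. \<alpha> = del j [x, y, z]) \<longleftrightarrow> \<alpha> \<in> {[y, z], [x, z], [x, y]}"
    by (simp add: Ex_less_Suc del_def) blast
  ultimately show ?thesis
    unfolding facet_def using assms by blast
qed

lemma triangle_distinct: "is_face m [x, y, z] \<Longrightarrow> x \<noteq> y \<and> y \<noteq> z \<and> x \<noteq> z"
  by (cases x; cases y; cases z) (simp only: is_face_triangle; elim conjE disjE; simp)

lemma incidence_triangle:
  assumes "x \<noteq> y" "y \<noteq> z" "x \<noteq> z"
  shows "incidence [y, z] [x, y, z] = 1" "incidence [x, z] [x, y, z] = - 1"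
    "incidence [x, y] [x, y, z] = 1"
proof -
  have "incidence \<alpha> [x, y, z] = (\<Sum>j<3. if del j [x, y, z] = \<alpha> then (-1) ^ j else 0)" for \<alpha>
    unfolding incidence_def by (subst sum.inter_filter[symmetric]) (auto intro: sum.cong)
  then show "incidence [y, z] [x, y, z] = 1" "incidence [x, z] [x, y, z] = - 1"
    "incidence [x, y] [x, y, z] = 1"
    using assms by (simp_all add: numeral_3_eq_3 del_def)
qed

text \<open>Modulo the boundary of the triangle, the paired edge is a combination of the other two
  edges. The edge \<open>[x, z]\<close> has sign \<open>-1\<close> in the boundary and the others have sign \<open>1\<close>, which
  gives the difference in the first case and the sum in the second.\<close>

lemma flow_triangle:
  assumes "\<alpha>\<^sub>0 \<noteq> \<alpha>" and W: "W m \<alpha>\<^sub>0 [x, y, z]"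
  shows "\<alpha>\<^sub>0 = [x, y] \<Longrightarrow> flow m [x, z] \<alpha> k \<Longrightarrow> flow m [y, z] \<alpha> l \<Longrightarrow> flow m \<alpha>\<^sub>0 \<alpha> (k - l)"
    and "\<alpha>\<^sub>0 = [x, z] \<Longrightarrow> flow m [x, y] \<alpha> k \<Longrightarrow> flow m [y, z] \<alpha> l \<Longrightarrow> flow m \<alpha>\<^sub>0 \<alpha> (k + l)"
proof -
  have face: "is_face m [x, y, z]" using W by (simp add: W_def)
  have ne: "x \<noteq> y" "y \<noteq> z" "x \<noteq> z" using triangle_distinct[OF face] by blast+
  have "W m \<alpha>' [x, y, z] \<longleftrightarrow> \<alpha>' = \<alpha>\<^sub>0" for \<alpha>'
    using W W_lower_partner[OF W] W_lower_partner[of m \<alpha>' "[x, y, z]"] by metis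
  then have A: "{\<alpha>'. facet m \<alpha>' [x, y, z] \<and> \<not> W m \<alpha>' [x, y, z]} = {[y, z], [x, z], [x, y]} - {\<alpha>\<^sub>0}"
    unfolding facet_triangle[OF face] by blast
  show "flow m \<alpha>\<^sub>0 \<alpha> (k - l)" if "\<alpha>\<^sub>0 = [x, y]" "flow m [x, z] \<alpha> k" "flow m [y, z] \<alpha> l"
  proof -
    have f: "flow m \<alpha>' \<alpha> (if \<alpha>' = [x, z] then k else l)" if "\<alpha>' \<in> {[x, z], [y, z]}" for \<alpha>'
      using that \<open>flow m [x, z] \<alpha> k\<close> \<open>flow m [y, z] \<alpha> l\<close> ne by auto
    have B: "{[x, z], [y, z]} = {\<alpha>'. facet m \<alpha>' [x, y, z] \<and> \<not> W m \<alpha>' [x, y, z]}"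
      unfolding A that(1) using ne by auto
    show ?thesis
      using flow_up[OF W assms(1) _ B f] ne that(1) by (simp add: incidence_triangle)
  qed
  show "flow m \<alpha>\<^sub>0 \<alpha> (k + l)" if "\<alpha>\<^sub>0 = [x, z]" "flow m [x, y] \<alpha> k" "flow m [y, z] \<alpha> l"
  proof -
    have f: "flow m \<alpha>' \<alpha> (if \<alpha>' = [x, y] then k else l)" if "\<alpha>' \<in> {[x, y], [y, z]}" for \<alpha>'
      using that \<open>flow m [x, y] \<alpha> k\<close> \<open>flow m [y, z] \<alpha> l\<close> ne by auto
    have B: "{[x, y], [y, z]} = {\<alpha>'. facet m \<alpha>' [x, y, z] \<and> \<not> W m \<alpha>' [x, y, z]}"
      unfolding A that(1) using ne by auto
    show ?thesis
      using flow_up[OF W assms(1) _ B f] ne that(1) by (simp add: incidence_triangle)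
  qed
qed

section \<open>Mixed paths from a critical triangle\<close>

text \<open>A path can only end in a critical edge, so a paired edge never counts as an end point.\<close>

lemma critical_unpaired:
  assumes "\<alpha> \<in> critical m k" shows "W m e \<beta> \<Longrightarrow> e \<noteq> \<alpha>" "W m \<beta> e \<Longrightarrow> e \<noteq> \<alpha>"
  using assms by (auto simp: critical_def)

context
  fixes m :: nat and \<alpha> :: face
  assumes m: "m \<ge> 3" and crit: "\<alpha> \<in> critical m 1"
begin

abbreviation hit :: "face \<Rightarrow> int" where
  "hit e \<equiv> of_bool (e = \<alpha>)"

lemma pred_m: "m - Suc 0 < m" "m - Suc 0 \<noteq> m" "m \<noteq> m - Suc 0"
  using m by simp_all

lemma flow_last_column:
  assumes "y \<in> {(m, m - 1), (m - 1, m)}"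
  shows "flow m [x, y] \<alpha> (hit [x, y])"
  by (rule flow_stop) (use assms W_last_column in blast)

lemma not_hit_into_last:
  assumes "is_face m [(a, b), (m, m - 1)]"
  shows "[(a, b), (m, m - 1)] \<noteq> \<alpha>"
proof -
  have "W m [(a, b)] [(a, b), (m, m - 1)]"
    using assms pairing.g[of b m a] by (simp add: W_def is_face_short; linarith)
  then show ?thesis by (rule critical_unpaired(2)[OF crit])
qed

text \<open>These edges are paired with a vertex, so the path can neither stop at a critical edge
  nor go on.\<close>

lemma flow_into_last:
  assumes "is_face m [(a, b), (m, m - 1)]"
  shows "flow m [(a, b), (m, m - 1)] \<alpha> 0"
  using flow_last_column[of "(m, m - 1)" "(a, b)"] not_hit_into_last[OF assms] by simp

lemma not_hit_row:
  assumes "1 \<le> a" "a < m - 1"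
  shows "[(a, m), (m - 1, m)] \<noteq> \<alpha>"
proof -
  have "a < m" using assms by simp
  then have "is_face m [(a, m), (m - 1, m)]" "is_face m [(a, m)]"
    using assms pred_m by (simp_all add: is_face_short)
  then have "W m [(a, m)] [(a, m), (m - 1, m)]"
    using pairing.h[OF assms(2)] by (simp add: W_def)
  then show ?thesis by (rule critical_unpaired(2)[OF crit])
qed

lemma flow_row_m:
  assumes "1 \<le> a" "a < c" "c < m"
  shows "flow m [(a, m), (c, m)] \<alpha> (hit [(a, m), (c, m)])"
proof (cases "c = m - 1")
  case False
  have "\<not> W m [(a, m), (c, m)] \<beta>" for \<beta>
  proof
    assume "W m [(a, m), (c, m)] \<beta>"
    then have "pairing m [(a, m), (c, m)] \<beta>" by (simp add: W_def)
    then show False using assms by cases auto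
  qed
  then show ?thesis by (rule flow_stop)
qed (simp add: flow_last_column)

lemma flow_horizontal_to_m:
  assumes "1 \<le> a" "a < m" "1 \<le> d" "d < m" "a \<noteq> d"
  shows "flow m [(a, d), (m, d)] \<alpha> 0"
proof (cases "d = m - 1")
  case True
  then show ?thesis using assms flow_into_last[of a d] by (simp add: is_face_short)
next
  case False
  then have "d < m - 1" using assms by simp
  have W: "W m [(a, d), (m, d)] [(a, d), (m, d), (m, m - 1)]"
    using assms \<open>d < m - 1\<close> pred_m pairing.d[of d m a] by (simp add: W_def is_face_short)
  have "flow m [(a, d), (m, d)] \<alpha> (0 - 0)"
    by (rule flow_triangle(1)[OF critical_unpaired(1)[OF crit W] W refl])
      (rule flow_into_last; use assms \<open>d < m - 1\<close> pred_m in \<open>simp add: is_face_short\<close>)+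
  then show ?thesis by simp
qed

lemma flow_diagonal_to_m:
  assumes "1 \<le> a" "a < m" "1 \<le> b" "b < d" "d < m" "a \<noteq> b"
  shows "flow m [(a, b), (m, d)] \<alpha> (hit [(m, b), (m, d)])"
proof (cases "d = m - 1")
  case True
  then show ?thesis using assms pred_m flow_into_last[of a b] not_hit_into_last[of m b]
    by (simp add: is_face_short)
next
  case False
  have W: "W m [(a, b), (m, d)] [(a, b), (m, b), (m, d)]"
    using assms False pairing.e[of a m b d m] by (simp add: W_def is_face_short)
  have "\<not> W m [(m, b), (m, d)] \<beta>" for \<beta>
  proof
    assume "W m [(m, b), (m, d)] \<beta>"
    then have "pairing m [(m, b), (m, d)] \<beta>" by (simp add: W_def)
    then show False using assms False by cases auto
  qed
  then have "flow m [(m, b), (m, d)] \<alpha> (hit [(m, b), (m, d)])"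
    by (rule flow_stop)
  from flow_triangle(2)[OF critical_unpaired(1)[OF crit W] W refl flow_horizontal_to_m this]
  show ?thesis using assms by simp
qed

text \<open>The triangle above a vertical edge moves it to the vertical line through \<open>m\<close>. The
  result does not depend on \<open>a\<close>, which is why the two vertical sides of a rectangle cancel. For
  \<open>d = m - 1\<close> the edge on that line is paired and the value is \<open>0\<close>.\<close>

lemma flow_vertical:
  assumes "1 \<le> a" "a < m" "1 \<le> b" "b < d" "d < m" "a \<noteq> b" "a \<noteq> d"
  shows "flow m [(a, b), (a, d)] \<alpha> (hit [(m, b), (m, d)])"
proof -
  have W: "W m [(a, b), (a, d)] (rect a m b d)"
    using assms pairing.a[of a m d b] by (simp add: W_def is_face_short)
  from flow_triangle(1)[OF critical_unpaired(1)[OF crit W] W refl flow_diagonal_to_m flow_horizontal_to_m]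
  show ?thesis using assms by simp
qed

text \<open>For \<open>c = m - 1\<close> the edge already ends in \<open>(m - 1, m)\<close>. If moreover \<open>d = m - 2\<close>, it is
  paired with a vertex, and the value is \<open>0\<close> because the edge is not critical.\<close>

lemma flow_vertical_to_m:
  assumes "1 \<le> c" "c < m" "1 \<le> d" "d < m" "c \<noteq> d"
  shows "flow m [(c, d), (c, m)] \<alpha> (hit [(c, d), (m - 1, m)])"
proof (cases "c = m - 1")
  case False
  then have "c < m - 1" using assms by simp
  have W: "W m [(c, d), (c, m)] (rect c (m - 1) d m)"
    using assms \<open>c < m - 1\<close> pred_m pairing.b[of c m d] by (simp add: W_def is_face_short)
  have "flow m [(c, m), (m - 1, m)] \<alpha> 0"
    using flow_last_column[of "(m - 1, m)" "(c, m)"] not_hit_row[of c] assms False by simp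
  from flow_triangle(1)[OF critical_unpaired(1)[OF crit W] W refl flow_last_column this]
  show ?thesis by simp
qed (simp add: flow_last_column)

lemma flow_diagonal_row_m:
  assumes "1 \<le> a" "a < c" "c < m" "1 \<le> d" "d < m" "a \<noteq> d"
  shows "flow m [(a, d), (c, m)] \<alpha> (hit [(a, d), (m - 1, m)] + hit [(a, m), (c, m)])"
proof (cases "c = m - 1")
  case True
  then show ?thesis
    using flow_last_column[of "(m - 1, m)" "(a, d)"] not_hit_row[of a] assms by simp
next
  case False
  have W: "W m [(a, d), (c, m)] (rect a c d m)"
    using assms False pairing.f[of a c d m m] by (simp add: W_def is_face_short)
  from flow_triangle(2)[OF critical_unpaired(1)[OF crit W] W refl flow_vertical_to_m flow_row_m]
  show ?thesis using assms by simp
qed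

text \<open>The triangle above a horizontal edge moves it to the line of height \<open>m\<close>. Besides the
  edge on that line, whose contribution does not depend on \<open>d\<close>, the two end points of the side
  each leave an edge to \<open>(m - 1, m)\<close>.\<close>

lemma flow_horizontal:
  assumes "1 \<le> a" "a < c" "c < m" "1 \<le> d" "d < m" "a \<noteq> d" "c \<noteq> d"
  shows "flow m [(a, d), (c, d)] \<alpha>
    (hit [(a, d), (m - 1, m)] + hit [(a, m), (c, m)] - hit [(c, d), (m - 1, m)])"
proof -
  have W: "W m [(a, d), (c, d)] [(a, d), (c, d), (c, m)]"
    using assms pairing.c[of d m c a] by (simp add: W_def is_face_short)
  from flow_triangle(1)[OF critical_unpaired(1)[OF crit W] W refl flow_diagonal_row_m flow_vertical_to_m]
  show ?thesis using assms by simp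
qed

lemma path_sum_rect:
  assumes "1 \<le> a" "a < c" "c < m" "1 \<le> b" "b < d" "d < m" "a \<noteq> b" "a \<noteq> d" "c \<noteq> b" "c \<noteq> d"
  shows "(\<Sum>p \<in> mixed_paths m (rect a c b d) \<alpha>. multiplicity p) =
    hit [(a, d), (m - 1, m)] - hit [(c, d), (m - 1, m)]
    - hit [(a, b), (m - 1, m)] + hit [(c, b), (m - 1, m)]"
proof -
  let ?H = "\<lambda>d. hit [(a, d), (m - 1, m)] + hit [(a, m), (c, m)] - hit [(c, d), (m - 1, m)]"
  let ?V = "hit [(m, b), (m, d)]"
  have face: "is_face m (rect a c b d)"
    using assms by (simp add: is_face_short)
  have crit2: "\<not> W m e (rect a c b d)" for e
  proof
    assume "W m e (rect a c b d)"
    then have "pairing m e (rect a c b d)" by (simp add: W_def)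
    then show False using assms by cases auto
  qed
  have A: "{[(a, d), (c, d)], [(a, b), (c, d)], [(a, b), (a, d)]} =
      {\<alpha>'. facet m \<alpha>' (rect a c b d) \<and> \<not> W m \<alpha>' (rect a c b d)}"
    using facet_triangle[OF face] crit2 by blast
  have W: "W m [(a, b), (c, d)] [(a, b), (c, b), (c, d)]"
    using assms pairing.e[of a c b d m] by (simp add: W_def is_face_short)
  \<comment> \<open>The diagonal turns into the lower horizontal and the right vertical side.\<close>
  have D: "flow m [(a, b), (c, d)] \<alpha> (?H b + ?V)"
    by (rule flow_triangle(2)[OF critical_unpaired(1)[OF crit W] W refl flow_horizontal flow_vertical])
      (use assms in auto)
  have H: "flow m [(a, d), (c, d)] \<alpha> (?H d)" by (rule flow_horizontal) (use assms in auto)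
  have V: "flow m [(a, b), (a, d)] \<alpha> ?V" by (rule flow_vertical) (use assms in auto)
  have ne: "a \<noteq> c" "b \<noteq> d" using assms by auto
  let ?n = "\<lambda>e. if e = [(a, d), (c, d)] then ?H d else if e = [(a, b), (a, d)] then ?V else ?H b + ?V"
  have f: "flow m \<alpha>' \<alpha> (?n \<alpha>')" if "\<alpha>' \<in> {[(a, d), (c, d)], [(a, b), (c, d)], [(a, b), (a, d)]}" for \<alpha>'
    using that D H V ne by auto
  have "(\<Sum>p \<in> mixed_paths m (rect a c b d) \<alpha>. multiplicity p) = ?H d - (?H b + ?V) + ?V"
    using path_sum[OF _ A f] ne by (simp add: incidence_triangle)
  then show ?thesis by simp
qed

end

section \<open>The coboundary as a mixed second difference\<close>

definition rectangle :: "nat \<Rightarrow> nat \<Rightarrow> nat \<Rightarrow> nat \<Rightarrow> nat \<Rightarrow> bool" where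
  "rectangle m a c b d \<longleftrightarrow> 1 \<le> a \<and> a < c \<and> c < m \<and> 1 \<le> b \<and> b < d \<and> d < m \<and>
     a \<noteq> b \<and> a \<noteq> d \<and> c \<noteq> b \<and> c \<noteq> d"

text \<open>Every other triangle is the upper face of a pairing: of (a), (b) or (f) if it first
  goes up and then right, and of (c), (d) or (e) if it first goes right and then up.\<close>

lemma critical_2_cases:
  assumes "F \<in> critical m 2"
  obtains a c b d where "F = rect a c b d" "rectangle m a c b d"
proof -
  have face: "is_face m F" and len: "length F = 3" and up: "\<And>G. pairing m G F \<Longrightarrow> \<not> is_face m G"
    using assms by (auto simp: critical_def faces_def W_def)
  then obtain a b c d e f where F: "F = [(a, b), (c, d), (e, f)]"
    by (auto simp: length_Suc_conv numeral_3_eq_3)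
  from face have bds: "1 \<le> a" "e \<le> m" "1 \<le> b" "f \<le> m" "a \<noteq> b" "c \<noteq> d" "e \<noteq> f"
    and shape: "a = c \<and> c < e \<and> b < d \<and> d = f \<or> a < c \<and> c = e \<and> b = d \<and> d < f"
    by (simp_all add: F is_face_triangle)
  from shape show thesis
  proof
    assume L: "a = c \<and> c < e \<and> b < d \<and> d = f"
    then have F: "F = rect a e b d" by (simp add: F)
    have N1: "\<not> (e = m \<and> d < m)"
      using pairing.a[of a m d b] up[of "[(a, b), (a, d)]"] bds L by (auto simp: F is_face_edge)
    have N2: "\<not> (e = m - 1 \<and> d = m)"
      using pairing.b[of a m b] up[of "[(a, b), (a, m)]"] bds L by (auto simp: F is_face_edge)
    have N3: "\<not> (b = e \<and> e < m \<and> d < m \<or> e + 1 < m \<and> d = m)"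
    proof
      assume h: "b = e \<and> e < m \<and> d < m \<or> e + 1 < m \<and> d = m"
      have ac: "a < e" "b < d" "a \<noteq> d" using L bds(6) by blast+
      have "pairing m [(a, b), (e, d)] F"
        using pairing.f[OF ac h] by (simp add: F)
      moreover have "is_face m [(a, b), (e, d)]"
        using bds(1-5,7) L by (simp add: is_face_edge)
      ultimately show False using up by blast
    qed
    have le: "e \<le> m" "d \<le> m" "e \<noteq> d" using bds L by blast+
    have "d < m"
    proof (rule ccontr)
      assume "\<not> d < m"
      then have "d = m" "e < m" using le by auto
      moreover from this have "e + 1 < m \<or> e = m - 1" by auto
      ultimately show False using N2 N3 by blast
    qed
    moreover from this have "e < m" using N1 le(1) by auto
    moreover from calculation have "b \<noteq> e" using N3 by blast
    ultimately have "rectangle m a e b d"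
      unfolding rectangle_def using bds L by auto
    then show thesis using that F by blast
  next
    assume U: "a < c \<and> c = e \<and> b = d \<and> d < f"
    then have F: "F = [(a, b), (c, b), (c, f)]" by (simp add: F)
    have N1: "\<not> (c < m \<and> f = m)"
      using pairing.c[of b m c a] up[of "[(a, b), (c, b)]"] bds U by (auto simp: F is_face_edge)
    have N2: "\<not> (c = m \<and> f = m - 1)"
      using pairing.d[of b m a] up[of "[(a, b), (m, b)]"] bds U by (auto simp: F is_face_edge)
    have N3: "\<not> ((c < m \<and> f < m) \<or> (c = m \<and> f + 1 < m))"
    proof
      assume h: "(c < m \<and> f < m) \<or> (c = m \<and> f + 1 < m)"
      have ac: "a < c" "b < f" "b \<noteq> c" using U bds(6) by blast+
      have "pairing m [(a, b), (c, f)] F"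
        using pairing.e[OF ac h] by (simp add: F)
      moreover have "is_face m [(a, b), (c, f)]"
        using bds(1-5,7) U by (simp add: is_face_edge)
      ultimately show False using up by blast
    qed
    have le: "c \<le> m" "f \<le> m" "c \<noteq> f" using bds U by blast+
    have "f < m"
      using N1 le by (metis le_neq_implies_less)
    moreover have "c = m"
      using N3 le \<open>f < m\<close> by (metis le_neq_implies_less)
    ultimately have "f + 1 < m \<or> f = m - 1" by auto
    then show thesis using N2 N3 \<open>c = m\<close> by blast
  qed
qed

lemma rect_critical: "rect a c b d \<in> critical m 2 \<longleftrightarrow> rectangle m a c b d"
proof
  assume "rect a c b d \<in> critical m 2"
  then show "rectangle m a c b d" by (cases rule: critical_2_cases) simp
next
  assume r: "rectangle m a c b d"
  have "\<not> pairing m (rect a c b d) G" for G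
  proof
    assume "pairing m (rect a c b d) G" then show False by cases auto
  qed
  moreover have "\<not> pairing m e (rect a c b d)" for e
  proof
    assume "pairing m e (rect a c b d)"
    then show False using r unfolding rectangle_def by cases auto
  qed
  moreover have "is_face m (rect a c b d)"
    using r by (simp add: is_face_triangle rectangle_def)
  ultimately show "rect a c b d \<in> critical m 2"
    by (simp add: critical_def faces_def W_def)
qed

text \<open>The excluded edge is the upper face of pairing (i).\<close>

lemma corner_critical:
  assumes "1 \<le> p" "p < m" "1 \<le> q" "q < m" "p \<noteq> q"
  shows "[(p, q), (m - 1, m)] \<in> critical m 1 \<longleftrightarrow> (p, q) \<noteq> (m - 1, m - 2)"
proof -
  have face: "is_face m [(p, q), (m - 1, m)]"
    using assms by (simp add: is_face_edge) linarith
  have up: "\<not> W m [(p, q), (m - 1, m)] G" for G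
    using W_last_column(2)[of m "(p, q)" "(m - 1, m)" G] by blast
  have down: "(p, q) = (m - 1, m - 2)" if "W m G [(p, q), (m - 1, m)]" for G
  proof -
    have "pairing m G [(p, q), (m - 1, m)]" using that by (simp add: W_def)
    then show ?thesis using assms by cases auto
  qed
  have "2 \<le> m" using assms by linarith
  then have "is_face m [(m - 1, m)]" if "1 \<le> m - 1"
    using that by (simp add: is_face_vertex)
  then have "W m [(m - 1, m)] [(p, q), (m - 1, m)]" if "(p, q) = (m - 1, m - 2)"
    using that pairing.i[of m] face assms(1) by (simp add: W_def)
  with face up down show ?thesis
    by (auto simp: critical_def faces_def)
qed

lemma finite_critical: "finite (critical m k)"
proof (rule finite_subset)
  show "critical m k \<subseteq> {F. set F \<subseteq> {1..m} \<times> {1..m} \<and> length F = Suc k}"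
    by (fastforce simp: critical_def faces_def is_face_def)
qed (rule finite_lists_length_eq, simp)

lemma sum_fun_apply: "(\<Sum>i \<in> A. f i) x = (\<Sum>i \<in> A. f i x)"
  by (induction A rule: infinite_finite_induct) simp_all

text \<open>The second difference of \<open>g\<close> over the rectangle spanned by the first and the last
  column of the triangle.\<close>

definition cross :: "nat \<Rightarrow> (nat \<Rightarrow> nat \<Rightarrow> 'r::comm_ring_1) \<Rightarrow> face \<Rightarrow> 'r" where
  "cross m g F =
     (if F \<in> critical m 2 then
        case (F ! 0, F ! 2) of ((a, b), (c, d)) \<Rightarrow> g a d - g c d - g a b + g c b
      else 0)"

lemma cross_rect:
  "rectangle m a c b d \<Longrightarrow> cross m g (rect a c b d) = g a d - g c d - g a b + g c b"
  by (simp add: cross_def rect_critical)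

lemma cross_eqI:
  assumes "\<And>F. F \<notin> critical m 2 \<Longrightarrow> f F = 0"
    and "\<And>a c b d. rectangle m a c b d \<Longrightarrow> f (rect a c b d) = g a d - g c d - g a b + g c b"
  shows "f = cross m g"
proof
  fix F show "f F = cross m g F"
  proof (cases "F \<in> critical m 2")
    case True
    then show ?thesis
      by (cases rule: critical_2_cases) (simp add: assms(2) cross_rect)
  qed (simp add: assms(1) cross_def)
qed

lemma coboundary_apply:
  "coboundary m k f F =
    (if F \<in> critical m (Suc k)
     then \<Sum>\<alpha> \<in> critical m k. f \<alpha> * of_int (\<Sum>p \<in> mixed_paths m F \<alpha>. multiplicity p) else 0)"
  by (simp add: coboundary_def sum_fun_apply scale_def dual_def finite_critical if_distrib cong: if_cong)

lemma coboundary_eq_cross: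
  fixes f :: "face \<Rightarrow> 'r::comm_ring_1"
  assumes "m \<ge> 3" and f: "f \<in> cochains m 1"
  shows "coboundary m 1 f = cross m (\<lambda>p q. f [(p, q), (m - 1, m)])"
proof (rule cross_eqI)
  fix a c b d assume r: "rectangle m a c b d"
  have hit: "(\<Sum>\<alpha> \<in> critical m 1. f \<alpha> * of_bool (e = \<alpha>)) = f e" for e
  proof -
    have "(\<Sum>\<alpha> \<in> critical m 1. f \<alpha> * of_bool (e = \<alpha>)) = (\<Sum>\<alpha> \<in> critical m 1. if e = \<alpha> then f \<alpha> else 0)"
      by (intro sum.cong) auto
    also have "\<dots> = f e"
      using f by (auto simp: finite_critical cochains_def)
    finally show ?thesis .
  qed
  let ?k = "\<lambda>p q. [(p, q), (m - 1, m)]"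
  have "coboundary m 1 f (rect a c b d) = (\<Sum>\<alpha> \<in> critical m 1. f \<alpha> * of_int (
      of_bool (?k a d = \<alpha>) - of_bool (?k c d = \<alpha>) - of_bool (?k a b = \<alpha>) + of_bool (?k c b = \<alpha>)))"
    using r path_sum_rect[OF \<open>m \<ge> 3\<close>, of _ a c b d]
    by (simp add: coboundary_apply rect_critical rectangle_def numeral_2_eq_2[symmetric] cong: sum.cong)
  also have "\<dots> = f (?k a d) - f (?k c d) - f (?k a b) + f (?k c b)"
    by (simp only: of_int_add of_int_diff of_int_of_bool distrib_left right_diff_distrib
      sum.distrib sum_subtractf hit)
  finally show "coboundary m 1 f (rect a c b d) = f (?k a d) - f (?k c d) - f (?k a b) + f (?k c b)" .
qed (simp add: coboundary_apply numeral_2_eq_2)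

text \<open>The only corner without a critical edge is \<open>(m - 1, m - 2)\<close>. Second differences ignore
  constants, so \<open>g\<close> may be shifted until it vanishes there.\<close>

lemma image_coboundary:
  assumes "m \<ge> 3"
  shows "coboundary m 1 ` cochains m 1 = range (cross m :: _ \<Rightarrow> face \<Rightarrow> 'r::comm_ring_1)"
proof (intro equalityI subsetI)
  fix h :: "face \<Rightarrow> 'r" assume "h \<in> range (cross m)"
  then obtain g where h: "h = cross m g" by auto
  define f where "f F = (if F \<in> critical m 1 then case F ! 0 of (p, q) \<Rightarrow> g p q - g (m - 1) (m - 2) else 0)" for F
  have f: "f \<in> cochains m 1" by (simp add: cochains_def f_def)
  have val: "f [(p, q), (m - 1, m)] = g p q - g (m - 1) (m - 2)"
    if "1 \<le> p" "p < m" "1 \<le> q" "q < m" "p \<noteq> q" for p q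
    using corner_critical[OF that] by (auto simp: f_def)
  have "cross m g = cross m (\<lambda>p q. f [(p, q), (m - 1, m)])"
  proof (rule cross_eqI)
    fix a c b d assume r: "rectangle m a c b d"
    show "cross m g (rect a c b d) = f [(a, d), (m - 1, m)] - f [(c, d), (m - 1, m)]
        - f [(a, b), (m - 1, m)] + f [(c, b), (m - 1, m)]"
      unfolding cross_rect[OF r] using r
      by (subst (1 2 3 4) val) (simp_all add: rectangle_def)
  qed (simp add: cross_def)
  then have "h = coboundary m 1 f"
    using coboundary_eq_cross[OF assms f] h by simp
  then show "h \<in> coboundary m 1 ` cochains m 1"
    using f by blast
qed (use coboundary_eq_cross[OF assms] in auto)

section \<open>Normal forms modulo the image of the coboundary\<close>

lemma cochains_diff: "f \<in> cochains m k \<Longrightarrow> g \<in> cochains m k \<Longrightarrow> f - g \<in> cochains m k"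
  by (simp add: cochains_def)

lemma cochains_sum: "(\<And>i. i \<in> A \<Longrightarrow> f i \<in> cochains m k) \<Longrightarrow> (\<Sum>i \<in> A. f i) \<in> cochains m k"
  by (simp add: cochains_def sum_fun_apply)

lemma dual_cochain: "F \<in> critical m k \<Longrightarrow> dual F \<in> cochains m k"
  by (auto simp: cochains_def dual_def)

lemma cross_cochain: "cross m g \<in> cochains m 2"
  by (simp add: cochains_def cross_def)

lemma cross_linear:
  "cross m (\<lambda>p q. g p q - h p q) = cross m g - cross m h"
  "cross m (\<lambda>p q. g p q + h p q) = cross m g + cross m h"
  "cross m (\<lambda>p q. - g p q) = - cross m g"
  by (simp_all add: fun_eq_iff cross_def split: prod.split)

lemma cross_zero: "cross m (\<lambda>p q. 0) = 0"
  by (simp add: fun_eq_iff cross_def split: prod.split)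

lemma cong_rel_iff:
  assumes "m \<ge> 3"
  shows "(f, g) \<in> cong_rel m \<longleftrightarrow>
    f \<in> cochains m 2 \<and> g \<in> cochains m 2 \<and> (\<exists>h. f - g = cross m h)"
  using image_coboundary[OF assms] by (auto simp: cong_rel_def)

lemma equiv_cong_rel:
  assumes "m \<ge> 3"
  shows "equiv (cochains m 2) (cong_rel m :: ((face \<Rightarrow> 'r::comm_ring_1) \<times> _) set)"
proof (rule equivI)
  show "cong_rel m \<subseteq> cochains m 2 \<times> (cochains m 2 :: (face \<Rightarrow> 'r) set)"
    by (auto simp: cong_rel_def)
  show "refl_on (cochains m 2) (cong_rel m :: ((face \<Rightarrow> 'r) \<times> _) set)"
    using cross_zero[of m] by (intro refl_onI) (auto simp: cong_rel_iff[OF assms] simp flip: cross_zero)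
  show "sym (cong_rel m :: ((face \<Rightarrow> 'r) \<times> _) set)"
  proof (rule symI)
    fix f g :: "face \<Rightarrow> 'r" assume "(f, g) \<in> cong_rel m"
    then obtain h where h: "f - g = cross m h" and fg: "f \<in> cochains m 2" "g \<in> cochains m 2"
      by (auto simp: cong_rel_iff[OF assms])
    have "g - f = cross m (\<lambda>p q. - h p q)"
      unfolding cross_linear h[symmetric] by simp
    with fg show "(g, f) \<in> cong_rel m"
      unfolding cong_rel_iff[OF assms] by blast
  qed
  show "trans (cong_rel m :: ((face \<Rightarrow> 'r) \<times> _) set)"
  proof (rule transI)
    fix f g h :: "face \<Rightarrow> 'r" assume *: "(f, g) \<in> cong_rel m" "(g, h) \<in> cong_rel m"
    then obtain k l where "f - g = cross m k" "g - h = cross m l"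
      by (auto simp: cong_rel_iff[OF assms])
    then have "f - h = cross m (\<lambda>p q. k p q + l p q)"
      unfolding cross_linear by (metis diff_add_cancel add_diff_eq)
    with * show "(f, h) \<in> cong_rel m"
      unfolding cong_rel_iff[OF assms] by blast
  qed
qed

lemma setC_iff:
  assumes "m \<ge> 5"
  shows "F \<in> setC m \<longleftrightarrow>
    (\<exists>c d. F = rect 1 c 2 d \<and> 3 \<le> c \<and> c < m \<and> 3 \<le> d \<and> d < m \<and> c \<noteq> d) \<or>
    (\<exists>d. F = rect 1 2 3 d \<and> 4 \<le> d \<and> d < m) \<or>
    (\<exists>c. F = rect 2 c 1 3 \<and> 4 \<le> c \<and> c < m) \<or> F = rect 2 3 1 4"
    (is "_ \<longleftrightarrow> ?R")
proof
  assume "F \<in> setC m"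
  then have "F \<in> {rect 1 c 2 d | c d. c \<in> {3..m - 1} \<and> d \<in> {3..m - 1} \<and> c \<noteq> d} \<union>
      {rect 1 2 3 d | d. d \<in> {4..m - 1}} \<union> {rect 2 c 1 3 | c. c \<in> {4..m - 1}} \<union> {rect 2 3 1 4}"
    by (simp add: setC_def)
  moreover have "x < m" if "x \<le> m - 1" for x using that assms by simp
  ultimately show ?R by auto
next
  assume R: ?R
  then have "F \<in> critical m 2"
    using assms by (elim disjE exE conjE) (simp_all add: rect_critical rectangle_def)
  moreover have "x \<le> m - 1" if "x < m" for x using that by simp
  ultimately show "F \<in> setC m"
    using R by (simp add: setC_def) blast
qed

text \<open>The listed positions off the diagonal are those at which a function of \<open>p\<close> plus a
  function of \<open>q\<close> can be given arbitrary values; the free entries that remain match the set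
  \<open>setC m\<close>.\<close>

definition normalised :: "(nat \<Rightarrow> nat \<Rightarrow> 'r::comm_ring_1) \<Rightarrow> bool" where
  "normalised g \<longleftrightarrow> (\<forall>p q. p \<le> 1 \<or> q = 2 \<or> p = 2 \<and> (q = 1 \<or> q = 3) \<longrightarrow> g p q = 0)"

lemma normalise:
  obtains h where "normalised h" "cross m h = cross m (g :: nat \<Rightarrow> nat \<Rightarrow> 'r::comm_ring_1)"
proof -
  \<comment> \<open>The functions \<open>u\<close> and \<open>v\<close> are fixed by the entries that have to vanish, in the order
    \<open>(1, q)\<close>, \<open>(2, 3)\<close>, \<open>(2, 1)\<close>, \<open>(p, 2)\<close>, starting from \<open>u 1 = 0\<close>.\<close>
  define u where "u p = (if p = 1 then 0 else if p = 2 then g 2 3 - g 1 3 else g p 2 - g 1 2)" for p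
  define v where "v q = (if q = 1 then g 2 1 - u 2 else g 1 q)" for q
  define h where "h p q = (if p \<le> 1 \<or> q = 2 \<or> p = 2 \<and> (q = 1 \<or> q = 3) then 0
    else g p q - u p - v q)" for p q
  have h: "h p q = g p q - u p - v q" if "1 \<le> p" "p \<noteq> q" for p q
    using that by (auto simp: h_def u_def v_def)
  have "cross m h = cross m g"
  proof (rule cross_eqI)
    fix a c b d assume r: "rectangle m a c b d"
    then have "1 \<le> a" "1 \<le> c" "a \<noteq> b" "a \<noteq> d" "c \<noteq> b" "c \<noteq> d"
      by (auto simp: rectangle_def)
    then show "cross m h (rect a c b d) = g a d - g c d - g a b + g c b"
      by (simp add: cross_rect[OF r] h)
  qed (simp add: cross_def)
  moreover have "normalised h" by (simp add: normalised_def h_def)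
  ultimately show thesis using that by blast
qed

text \<open>Each rectangle in \<open>setC m\<close> gives one equation. They are solved one entry at a time:
  first the entries with both indices at least \<open>3\<close>, then those with \<open>p = 2\<close>, then those with
  \<open>q = 1\<close>, where \<open>(3, 1)\<close> comes last.\<close>

lemma normalised_eqD:
  assumes m: "m \<ge> 5" and n: "normalised g" and C: "\<And>F. F \<in> setC m \<Longrightarrow> cross m g F = 0"
    and pq: "1 \<le> p" "p < m" "1 \<le> q" "q < m" "p \<noteq> q"
  shows "g p q = 0"
proof -
  have z: "g p q = 0" if "p \<le> 1 \<or> q = 2 \<or> p = 2 \<and> (q = 1 \<or> q = 3)" for p q
    using n that unfolding normalised_def by blast
  have eq: "g a d - g c d - g a b + g c b = 0" if "rect a c b d \<in> setC m" for a c b d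
    using C[OF that] that by (simp add: cross_rect setC_def rect_critical)
  have inner: "g c d = 0" if "3 \<le> c" "c < m" "3 \<le> d" "d < m" "c \<noteq> d" for c d
  proof -
    have "rect 1 c 2 d \<in> setC m" using that unfolding setC_iff[OF m] by blast
    from eq[OF this] show ?thesis by (simp add: z)
  qed
  have row2: "g 2 d = 0" if "4 \<le> d" "d < m" for d
  proof -
    have "rect 1 2 3 d \<in> setC m" using that unfolding setC_iff[OF m] by blast
    from eq[OF this] show ?thesis by (simp add: z)
  qed
  have col1: "g c 1 = 0" if "4 \<le> c" "c < m" for c
  proof -
    have "rect 2 c 1 3 \<in> setC m" using that unfolding setC_iff[OF m] by blast
    from eq[OF this] show ?thesis using inner[of c 3] that by (simp add: z)
  qed
  have "g 3 1 = 0"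
  proof -
    have "rect 2 3 1 4 \<in> setC m" unfolding setC_iff[OF m] by blast
    from eq[OF this] show ?thesis using row2[of 4] inner[of 3 4] m by (simp add: z)
  qed
  then have col1': "g c 1 = 0" if "3 \<le> c" "c < m" for c
    using col1[of c] that by (cases "c = 3") auto
  consider "p = 1 \<or> q = 2 \<or> p = 2 \<and> (q = 1 \<or> q = 3)" | "p = 2" "4 \<le> q" | "3 \<le> p" "q = 1"
    | "3 \<le> p" "3 \<le> q"
    using pq by fastforce
  then show ?thesis
    using z row2 col1' inner pq by cases auto
qed

lemma normalised_cross_eq_0:
  assumes "m \<ge> 5" "normalised g" "\<And>F. F \<in> setC m \<Longrightarrow> cross m g F = 0"
  shows "cross m g = 0"
proof -
  have "0 = cross m g"
  proof (rule cross_eqI)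
    fix a c b d assume r: "rectangle m a c b d"
    show "0 (rect a c b d) = g a d - g c d - g a b + g c b"
      using r by (simp add: rectangle_def normalised_eqD[OF assms])
  qed simp
  then show ?thesis ..
qed

text \<open>The same triangular system, solved for arbitrary values. Every new entry has
  coefficient \<open>1\<close> or \<open>-1\<close>, so the ring is arbitrary.\<close>

lemma prescribe_on_C:
  fixes t :: "face \<Rightarrow> 'r::comm_ring_1"
  assumes m: "m \<ge> 5"
  obtains g where "normalised g" "\<And>F. F \<in> setC m \<Longrightarrow> cross m g F = t F"
proof -
  define k where "k c d = - t (rect 1 c 2 d)" for c d
  define k2 where "k2 d = - t (rect 1 2 3 d)" for d
  define g where "g p q =
    (if p \<le> 1 \<or> q = 2 \<or> p = 2 \<and> (q = 1 \<or> q = 3) then 0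
     else if p = 2 then k2 q
     else if q = 1 then (if p = 3 then t (rect 2 3 1 4) + k 3 4 - k2 4 else t (rect 2 p 1 3) + k p 3)
     else k p q)" for p q
  have "cross m g F = t F" if F: "F \<in> setC m" for F
  proof -
    have val: "cross m g (rect a c b d) = g a d - g c d - g a b + g c b" if "rect a c b d = F" for a c b d
      using F that by (auto simp: cross_rect setC_def rect_critical)
    from F consider c d where "F = rect 1 c 2 d" "3 \<le> c" "3 \<le> d" | d where "F = rect 1 2 3 d" "4 \<le> d"
      | c where "F = rect 2 c 1 3" "4 \<le> c" | "F = rect 2 3 1 4"
      unfolding setC_iff[OF m] by blast
    then show ?thesis
      by cases (simp_all add: val, simp_all add: g_def k_def k2_def)
  qed
  moreover have "normalised g" by (simp add: normalised_def g_def)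
  ultimately show thesis using that by blast
qed

lemma lincombB_apply: "lincombB m s F = (if F \<in> setB m then s F else 0)"
proof -
  have "finite (setB m)" unfolding setB_def using finite_critical by blast
  then show ?thesis
    by (simp add: lincombB_def sum_fun_apply scale_def dual_def if_distrib cong: if_cong)
qed

lemma lincombB_cochain: "lincombB m s \<in> cochains m 2"
  by (simp add: cochains_def lincombB_apply setB_def)

text \<open>A coboundary that agrees with \<open>f\<close> on \<open>setC m\<close> is subtracted; what is left is supported
  on \<open>setB m\<close>.\<close>

lemma reduce_to_B:
  fixes f :: "face \<Rightarrow> 'r::comm_ring_1"
  assumes m: "m \<ge> 5" and f: "f \<in> cochains m 2"
  obtains g where "normalised g" "f - lincombB m (restrict (f - cross m g) (setB m)) = cross m g"
proof -
  obtain g where g: "normalised g" "\<And>F. F \<in> setC m \<Longrightarrow> cross m g F = f F"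
    using prescribe_on_C[OF m, of f] by blast
  have "(f - lincombB m (restrict (f - cross m g) (setB m))) F = cross m g F" for F
  proof (cases "F \<in> setB m")
    case False
    then have "F \<notin> critical m 2 \<or> F \<in> setC m" by (auto simp: setB_def)
    then show ?thesis
      using False f g(2) cross_cochain[of m g] by (auto simp: lincombB_apply cochains_def)
  qed (simp add: lincombB_apply)
  with g(1) show thesis using that by blast
qed

text \<open>The difference of two congruent combinations is a coboundary that vanishes on \<open>setC m\<close>,
  hence zero.\<close>

lemma lincombB_unique:
  fixes s s' :: "face \<Rightarrow> 'r::comm_ring_1"
  assumes m: "m \<ge> 5" and "(lincombB m s, lincombB m s') \<in> cong_rel m"
    and ext: "s \<in> setB m \<rightarrow>\<^sub>E UNIV" "s' \<in> setB m \<rightarrow>\<^sub>E UNIV"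
  shows "s = s'"
proof -
  obtain h where "lincombB m s - lincombB m s' = cross m h"
    using assms(2) m by (auto simp: cong_rel_iff)
  then obtain g where g: "normalised g" "lincombB m s - lincombB m s' = cross m g"
    using normalise[of m h] by metis
  have "cross m g F = 0" if "F \<in> setC m" for F
    using that unfolding g(2)[symmetric] by (simp add: lincombB_apply setB_def)
  then have "cross m g = 0" by (rule normalised_cross_eq_0[OF m g(1)])
  then have eq: "lincombB m s F = lincombB m s' F" for F
    using g(2) by (metis eq_iff_diff_eq_0)
  show "s = s'"
  proof (rule PiE_ext[OF ext])
    fix F assume "F \<in> setB m"
    then show "s F = s' F" using eq[of F] by (simp add: lincombB_apply)
  qed
qed

section \<open>The six families of congruences\<close>

lemma dual_eq_iff: "(dual F :: face \<Rightarrow> 'r::comm_ring_1) = dual G \<longleftrightarrow> F = G"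
  by (metis dual_def zero_neq_one)

text \<open>Distinct dual cochains are indicators of distinct faces, so a sum of such duals is the
  indicator of a set of faces. The index set is finite because it embeds into the finite set of
  critical faces.\<close>

lemma sum_dual_apply:
  fixes \<psi> :: "'i \<Rightarrow> face \<Rightarrow> 'r::comm_ring_1"
  assumes "inj_on \<psi> A" and "\<psi> ` A \<subseteq> dual ` critical m k"
  shows "(\<Sum>i \<in> A. \<psi> i) F = of_bool (dual F \<in> \<psi> ` A)"
proof -
  have fin: "finite (\<psi> ` A)"
    by (rule finite_subset[OF assms(2)]) (simp add: finite_critical)
  have "(\<Sum>i \<in> A. \<psi> i) F = (\<Sum>f \<in> \<psi> ` A. f F)"
    by (simp add: sum_fun_apply sum.reindex[OF assms(1)])
  also have "\<dots> = (\<Sum>f \<in> \<psi> ` A. if f = dual F then 1 else 0)"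
  proof (rule sum.cong[OF refl])
    fix f assume "f \<in> \<psi> ` A"
    then obtain G where "f = dual G" using assms(2) by blast
    then show "f F = (if f = dual F then 1 else 0)"
      by (simp add: dual_eq_iff) (simp add: dual_def)
  qed
  also have "\<dots> = of_bool (dual F \<in> \<psi> ` A)"
    using fin by simp
  finally show ?thesis .
qed

definition matrix_unit :: "nat \<Rightarrow> nat \<Rightarrow> nat \<Rightarrow> nat \<Rightarrow> 'r::comm_ring_1" where
  "matrix_unit p q p' q' = of_bool (p' = p \<and> q' = q)"

lemma equation_cochains:
  assumes "equation m l r" shows "l \<in> cochains m 2" "r \<in> cochains m 2"
  using assms by (cases; auto intro!: cochains_diff cochains_sum dual_cochain)+

text \<open>On the rectangle with coordinates \<open>a\<close>, \<open>c\<close>, \<open>b\<close>, \<open>d\<close>, each sum in the congruences reads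
  off a condition on these coordinates. The last two are the sums with restricted ranges.\<close>

lemma dual_sums:
  assumes r: "rectangle m a c b d"
  shows
    "(\<Sum>x | rect x k y l \<in> critical m 2. dual (rect x k y l)) (rect a c b d) =
       (of_bool (c = k \<and> b = y \<and> d = l) :: 'r::comm_ring_1)"
    "(\<Sum>x | rect k x y l \<in> critical m 2. dual (rect k x y l)) (rect a c b d) =
       (of_bool (a = k \<and> b = y \<and> d = l) :: 'r::comm_ring_1)"
    "(\<Sum>(x, y, z) | y \<noteq> l \<and> z \<in> {1, l} \<and> rect x k z y \<in> critical m 2. dual (rect x k z y)) (rect a c b d) =
       (of_bool (c = k \<and> (b = 1 \<or> b = l) \<and> d \<noteq> l) :: 'r::comm_ring_1)"
    "(\<Sum>(x, y, z) | y \<noteq> l \<and> z \<in> {1, l} \<and> rect k x z y \<in> critical m 2. dual (rect k x z y)) (rect a c b d) =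
       (of_bool (a = k \<and> (b = 1 \<or> b = l) \<and> d \<noteq> l) :: 'r::comm_ring_1)"
    "(\<Sum>(x, y) | rect x k y l \<in> critical m 2. dual (rect x k y l)) (rect a c b d) =
       (of_bool (c = k \<and> d = l) :: 'r::comm_ring_1)"
    "(\<Sum>(x, y) | rect k x y l \<in> critical m 2. dual (rect k x y l)) (rect a c b d) =
       (of_bool (a = k \<and> d = l) :: 'r::comm_ring_1)"
    "(\<Sum>(x, y) | rect x k l y \<in> critical m 2. dual (rect x k l y)) (rect a c b d) =
       (of_bool (c = k \<and> b = l) :: 'r::comm_ring_1)"
    "(\<Sum>(x, y) | rect k x l y \<in> critical m 2. dual (rect k x l y)) (rect a c b d) =
       (of_bool (a = k \<and> b = l) :: 'r::comm_ring_1)"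
    "(\<Sum>(x, y) | (x, y) \<noteq> z \<and> rect k x y l \<in> critical m 2. dual (rect k x y l)) (rect a c b d) =
       (of_bool (a = k \<and> d = l \<and> (c, b) \<noteq> z) :: 'r::comm_ring_1)"
    "(\<Sum>(x, y) | n < y \<and> rect x k l y \<in> critical m 2. dual (rect x k l y)) (rect a c b d) =
       (of_bool (c = k \<and> b = l \<and> n < d) :: 'r::comm_ring_1)"
  by (subst sum_dual_apply[where m = m and k = 2];
      use r in \<open>auto simp: inj_on_def dual_eq_iff image_iff rect_critical\<close>)+

lemmas evaluate = zip_Cons_Cons zip_Nil minus_apply

text \<open>Cochains in degree two are determined by their values on rectangles, so a congruence is
  checked one rectangle at a time.\<close>

lemma equation_differenceI:
  assumes "equation m l r"
    and "\<And>a c b d. rectangle m a c b d \<Longrightarrow> (l - r) (rect a c b d) = g a d - g c d - g a b + g c b"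
  shows "l - r = cross m g" and "\<exists>l r. equation m l r \<and> l - r = cross m g"
proof -
  show "l - r = cross m g"
    using cochains_diff[OF equation_cochains[OF assms(1)]] assms(2)
    by (intro cross_eqI) (auto simp: cochains_def)
  with assms(1) show "\<exists>l r. equation m l r \<and> l - r = cross m g" by blast
qed

lemma E1_difference:
  assumes "3 < k" "k < m"
  shows "\<exists>L R :: face \<Rightarrow> 'r::comm_ring_1. equation m L R \<and>
    L - R = cross m (\<lambda>p q. - matrix_unit k 3 p q - matrix_unit k 1 p q)"
  by (rule equation_differenceI(2)[OF equation.E1[OF assms]])
    (simp only: evaluate dual_sums, auto simp: matrix_unit_def rectangle_def)

lemma E2_difference:
  shows "\<exists>L R :: face \<Rightarrow> 'r::comm_ring_1. equation m L R \<and>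
    L - R = cross m (\<lambda>p q. - matrix_unit 3 4 p q - matrix_unit 3 1 p q)"
  by (rule equation_differenceI(2)[OF equation.E2])
    (simp only: evaluate dual_sums, auto simp: matrix_unit_def rectangle_def)

lemma E3_difference:
  assumes "3 \<le> k" "k \<noteq> l" "4 \<le> l" "(k, l) \<noteq> (3, 4)" "k < m" "l < m"
  shows "\<exists>L R :: face \<Rightarrow> 'r::comm_ring_1. equation m L R \<and>
    L - R = cross m (\<lambda>p q. - matrix_unit k l p q)"
  by (rule equation_differenceI(2)[OF equation.E3[OF assms]])
    (simp only: evaluate dual_sums, auto simp: matrix_unit_def rectangle_def)

lemma E4_difference:
  shows "\<exists>L R :: face \<Rightarrow> 'r::comm_ring_1. equation m L R \<and>
    L - R = cross m (\<lambda>p q. matrix_unit 3 1 p q - matrix_unit 2 4 p q)"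
  by (rule equation_differenceI(2)[OF equation.E4])
    (simp only: evaluate dual_sums, auto simp: matrix_unit_def rectangle_def)

lemma E5_difference:
  assumes "4 < l" "l < m"
  shows "\<exists>L R :: face \<Rightarrow> 'r::comm_ring_1. equation m L R \<and>
    L - R = cross m (\<lambda>p q. - matrix_unit 2 l p q)"
  by (rule equation_differenceI(2)[OF equation.E5[OF assms]])
    (simp only: evaluate dual_sums, auto simp: matrix_unit_def rectangle_def)

lemma E6_difference:
  assumes "2 < k" "k < m"
  shows "\<exists>L R :: face \<Rightarrow> 'r::comm_ring_1. equation m L R \<and>
    L - R = cross m (\<lambda>p q. matrix_unit k 1 p q)"
  by (rule equation_differenceI(2)[OF equation.E6[OF assms]])
    (simp only: evaluate dual_sums, auto simp: matrix_unit_def rectangle_def)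

lemma equation_cross:
  fixes l r :: "face \<Rightarrow> 'r::comm_ring_1"
  assumes "equation m l r"
  shows "\<exists>g. l - r = cross m g"
  using assms
proof induction
  case (E1 c)
  show ?case
    by (rule exI, rule equation_differenceI(1)[OF equation.E1[OF E1],
        where g = "\<lambda>p q. - matrix_unit c 3 p q - matrix_unit c 1 p q"])
      (simp only: evaluate dual_sums, auto simp: matrix_unit_def rectangle_def)
next
  case E2
  show ?case
    by (rule exI, rule equation_differenceI(1)[OF equation.E2,
        where g = "\<lambda>p q. - matrix_unit 3 4 p q - matrix_unit 3 1 p q"])
      (simp only: evaluate dual_sums, auto simp: matrix_unit_def rectangle_def)
next
  case (E3 c d)
  show ?case
    by (rule exI, rule equation_differenceI(1)[OF equation.E3[OF E3],
        where g = "\<lambda>p q. - matrix_unit c d p q"])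
      (simp only: evaluate dual_sums, auto simp: matrix_unit_def rectangle_def)
next
  case E4
  show ?case
    by (rule exI, rule equation_differenceI(1)[OF equation.E4,
        where g = "\<lambda>p q. matrix_unit 3 1 p q - matrix_unit 2 4 p q"])
      (simp only: evaluate dual_sums, auto simp: matrix_unit_def rectangle_def)
next
  case (E5 d)
  show ?case
    by (rule exI, rule equation_differenceI(1)[OF equation.E5[OF E5],
        where g = "\<lambda>p q. - matrix_unit 2 d p q"])
      (simp only: evaluate dual_sums, auto simp: matrix_unit_def rectangle_def)
next
  case (E6 c)
  show ?case
    by (rule exI, rule equation_differenceI(1)[OF equation.E6[OF E6],
        where g = "\<lambda>p q. matrix_unit c 1 p q"])
      (simp only: evaluate dual_sums, auto simp: matrix_unit_def rectangle_def)
qed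

text \<open>Only the entries in the grid \<open>{1..<m} \<times> {1..<m}\<close> enter a second difference.\<close>

lemma cross_expansion:
  "cross m g = (\<Sum>p = 1..<m. \<Sum>q = 1..<m. scale (g p q) (cross m (matrix_unit p q)))"
proof -
  have pick: "(\<Sum>p = 1..<m. \<Sum>q = 1..<m. g p q * matrix_unit p q a b) = g a b"
    if "1 \<le> a" "a < m" "1 \<le> b" "b < m" for a b
  proof -
    have "(\<Sum>p = 1..<m. \<Sum>q = 1..<m. g p q * matrix_unit p q a b) =
        (\<Sum>p = 1..<m. \<Sum>q = 1..<m. if q = b then if p = a then g p q else 0 else 0)"
      by (intro sum.cong) (auto simp: matrix_unit_def)
    also have "\<dots> = g a b" using that by simp
    finally show ?thesis .
  qed
  show ?thesis
  proof (rule cross_eqI[symmetric])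
    fix a c b d assume r: "rectangle m a c b d"
    then have range: "1 \<le> a" "a < m" "1 \<le> c" "c < m" "1 \<le> b" "b < m" "1 \<le> d" "d < m"
      by (auto simp: rectangle_def)
    show "(\<Sum>p = 1..<m. \<Sum>q = 1..<m. scale (g p q) (cross m (matrix_unit p q))) (rect a c b d) =
        g a d - g c d - g a b + g c b"
      unfolding sum_fun_apply scale_def cross_rect[OF r] distrib_left right_diff_distrib
        sum.distrib sum_subtractf
      by (simp only: pick range)
  qed (simp add: sum_fun_apply scale_def cross_def)
qed

text \<open>The congruences give signed matrix units at all free positions except \<open>(p, 3)\<close>,
  \<open>(3, 4)\<close> and \<open>(2, 4)\<close>, where the unit comes together with the one at \<open>(p, 1)\<close> or \<open>(3, 1)\<close>. The
  units at \<open>(p, 1)\<close> are obtained alone and are subtracted.\<close>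

lemma matrix_unit_in_span:
  fixes m :: nat
  defines "S \<equiv> cochain.span {l - r | l r :: face \<Rightarrow> 'r::comm_ring_1. equation m l r}"
  assumes m: "m \<ge> 5" and pq: "2 \<le> p" "p < m" "1 \<le> q" "q < m" "p \<noteq> q" "q \<noteq> 2"
    and not: "p = 2 \<Longrightarrow> 4 \<le> q"
  shows "(cross m (matrix_unit p q) :: face \<Rightarrow> 'r) \<in> S"
proof -
  have base: "cross m g \<in> S" if ex: "\<exists>l r :: face \<Rightarrow> 'r. equation m l r \<and> l - r = cross m g" for g
  proof -
    obtain l r :: "face \<Rightarrow> 'r" where lr: "equation m l r" "l - r = cross m g" using ex by blast
    have "l - r \<in> S" unfolding S_def by (rule cochain.span_base) (use lr(1) in blast)
    then show ?thesis unfolding lr(2) .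
  qed
  have neg: "f \<in> S" if "- f \<in> S" for f
    using cochain.span_neg[OF that[unfolded S_def]] unfolding S_def minus_minus .
  have sub: "f \<in> S" if "g - f \<in> S" "g \<in> S" for f g
  proof -
    have "g - (g - f) \<in> S"
      using cochain.span_diff[OF that(2)[unfolded S_def] that(1)[unfolded S_def]] unfolding S_def .
    moreover have "g - (g - f) = f" by simp
    ultimately show ?thesis by (rule back_subst)
  qed
  have col1: "cross m (matrix_unit k 1) \<in> S" if "2 < k" "k < m" for k
    by (rule base[OF E6_difference[OF that]])
  have shifted: "cross m (matrix_unit k l) \<in> S"
    if "cross m (\<lambda>p q. - matrix_unit k l p q - matrix_unit k 1 p q) \<in> S" "2 < k" "k < m" for k l
  proof -
    have "- cross m (matrix_unit k l) - cross m (matrix_unit k 1) \<in> S"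
      using that(1) unfolding cross_linear .
    from cochain.span_add[OF this[unfolded S_def] col1[OF that(2,3), unfolded S_def]]
    have "- cross m (matrix_unit k l) \<in> S" unfolding S_def by simp
    then show ?thesis by (rule neg)
  qed
  have neg_base: "cross m (matrix_unit k l) \<in> S"
    if "\<exists>L R :: face \<Rightarrow> 'r. equation m L R \<and>
    L - R = cross m (\<lambda>p q. - matrix_unit k l p q)" for k l
    by (rule neg) (use base[OF that] in \<open>simp only: cross_linear\<close>)
  consider "2 < p" "q = 1" | "3 < p" "q = 3" | "p = 3" "q = 4" | "3 \<le> p" "4 \<le> q" "(p, q) \<noteq> (3, 4)"
    | "p = 2" "q = 4" | "p = 2" "4 < q"
  proof -
    have "p = 2 \<or> p = 3 \<or> 3 < p" using pq(1) by linarith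
    moreover have "q = 1 \<or> q = 3 \<or> q = 4 \<or> 4 < q" using pq(3,6) by linarith
    ultimately show thesis using that not pq(5) by (elim disjE; simp)
  qed
  then show ?thesis
  proof cases
    case 1
    show ?thesis unfolding 1(2) by (rule col1[OF 1(1) pq(2)])
  next
    case 2
    then have "2 < p" by simp
    with base[OF E1_difference[OF 2(1) pq(2)]] show ?thesis
      unfolding 2(2) using pq(2) by (rule shifted)
  next
    case 3
    have "2 < (3::nat)" "3 < m" using m by simp_all
    with base[OF E2_difference] show ?thesis
      unfolding 3 by (rule shifted)
  next
    case 4
    show ?thesis
      by (rule neg_base[OF E3_difference[OF 4(1) pq(5) 4(2) 4(3) pq(2) pq(4)]])
  next
    case 5
    have "cross m (matrix_unit 3 1) \<in> S" by (rule col1) (use m in simp_all)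
    moreover have "cross m (matrix_unit 3 1) - cross m (matrix_unit 2 4) \<in> S"
      using base[OF E4_difference] unfolding cross_linear .
    ultimately show ?thesis unfolding 5 by (rule sub[rotated])
  next
    case 6
    show ?thesis unfolding 6(1) by (rule neg_base[OF E5_difference[OF 6(2) pq(4)]])
  qed
qed

lemma normalised_in_span:
  fixes g :: "nat \<Rightarrow> nat \<Rightarrow> 'r::comm_ring_1"
  assumes m: "m \<ge> 5" and g: "normalised g"
  shows "cross m g \<in> cochain.span {l - r | l r. equation m l r}"
  unfolding cross_expansion[of m g]
proof (intro cochain.span_sum)
  fix p q assume pq: "p \<in> {1..<m}" "q \<in> {1..<m}"
  have p: "p < m" and q: "1 \<le> q" "q < m" using pq by auto
  show "scale (g p q) (cross m (matrix_unit p q)) \<in> cochain.span {l - r | l r. equation m l r}"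
  proof (cases "p \<le> 1 \<or> q = 2 \<or> p = 2 \<and> (q = 1 \<or> q = 3)")
    case True
    then have "g p q = 0" using g unfolding normalised_def by blast
    then have "scale (g p q) (cross m (matrix_unit p q)) = 0" by simp
    then show ?thesis by (simp only: cochain.span_zero)
  next
    case False
    then have "2 \<le> p" "q \<noteq> 2" by auto
    show ?thesis
    proof (cases "p = q")
      case True
      have u: "matrix_unit p q x y = (0 :: 'r)" if "x \<noteq> y" for x y
        using that True by (auto simp: matrix_unit_def)
      have "(0 :: face \<Rightarrow> 'r) = cross m (matrix_unit p q)"
        by (rule cross_eqI) (simp_all add: u rectangle_def)
      then have "scale (g p q) (cross m (matrix_unit p q)) = 0" by simp
      then show ?thesis by (simp only: cochain.span_zero)
    next
      case ne: False
      have "4 \<le> q" if "p = 2"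
      proof -
        have "q \<noteq> 1" "q \<noteq> 3" using False that by blast+
        with q(1) \<open>q \<noteq> 2\<close> show ?thesis by linarith
      qed
      from matrix_unit_in_span[OF m \<open>2 \<le> p\<close> p q ne \<open>q \<noteq> 2\<close> this] show ?thesis
        by (rule cochain.span_scale)
    qed
  qed
qed

lemma cohomology_class_eq_iff:
  assumes "m \<ge> 3" "f \<in> cochains m 2" "g \<in> cochains m 2"
  shows "cohomology_class m f = cohomology_class m g \<longleftrightarrow> (f, g) \<in> cong_rel m"
  unfolding cohomology_class_def
  by (rule eq_equiv_class_iff[OF equiv_cong_rel[OF assms(1)] assms(2,3)])

section \<open>The basis of the second cohomology\<close>

theorem corollary4p10:
  fixes m :: nat
  assumes "m \<ge> 5"
  shows "(\<forall>h \<in> (H2 m :: (face \<Rightarrow> 'r::comm_ring_1) set set).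
            \<exists>!s. s \<in> setB m \<rightarrow>\<^sub>E UNIV \<and> h = cohomology_class m (lincombB m s)) \<and>
         (\<forall>(l :: face \<Rightarrow> 'r) r. equation m l r \<longrightarrow> (l, r) \<in> cong_rel m) \<and>
         (\<forall>\<gamma> \<in> setC m. \<exists>s :: face \<Rightarrow> 'r.
            cohomology_class m (dual \<gamma>) = cohomology_class m (lincombB m s) \<and>
            dual \<gamma> - lincombB m s \<in> cochain.span {l - r | l r. equation m l r})"
proof (intro conjI ballI allI impI)
  have m3: "m \<ge> 3" using assms by simp
  have same_class: "cohomology_class m f = cohomology_class m (lincombB m s)"
    if "f \<in> cochains m 2" "f - lincombB m s = cross m g" for f g and s :: "face \<Rightarrow> 'r"
  proof (rule iffD2[OF cohomology_class_eq_iff[OF m3 that(1) lincombB_cochain]])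
    show "(f, lincombB m s) \<in> cong_rel m"
      unfolding cong_rel_iff[OF m3] using that lincombB_cochain by blast
  qed
  show "\<exists>!s. s \<in> setB m \<rightarrow>\<^sub>E UNIV \<and> h = cohomology_class m (lincombB m s)"
    if "h \<in> H2 m" for h :: "(face \<Rightarrow> 'r) set"
  proof (rule ex_ex1I)
    from that obtain f where f: "f \<in> cochains m 2" "h = cohomology_class m f"
      unfolding H2_def cohomology_class_def by (rule quotientE)
    obtain g where "f - lincombB m (restrict (f - cross m g) (setB m)) = cross m g"
      using reduce_to_B[OF assms f(1)] by blast
    from same_class[OF f(1) this] f(2)
    have "h = cohomology_class m (lincombB m (restrict (f - cross m g) (setB m)))"
      by simp
    moreover have "restrict (f - cross m g) (setB m) \<in> setB m \<rightarrow>\<^sub>E UNIV" by simp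
    ultimately show "\<exists>s. s \<in> setB m \<rightarrow>\<^sub>E UNIV \<and> h = cohomology_class m (lincombB m s)"
      by blast
  next
    fix s s' :: "face \<Rightarrow> 'r"
    assume s: "s \<in> setB m \<rightarrow>\<^sub>E UNIV \<and> h = cohomology_class m (lincombB m s)"
      and s': "s' \<in> setB m \<rightarrow>\<^sub>E UNIV \<and> h = cohomology_class m (lincombB m s')"
    then have "cohomology_class m (lincombB m s) = cohomology_class m (lincombB m s')" by simp
    then have "(lincombB m s, lincombB m s') \<in> cong_rel m"
      by (rule iffD1[OF cohomology_class_eq_iff[OF m3 lincombB_cochain lincombB_cochain]])
    then show "s = s'"
      by (rule lincombB_unique[OF assms _ conjunct1[OF s] conjunct1[OF s']])
  qed
  show "(l, r) \<in> cong_rel m" if "equation m l r" for l r :: "face \<Rightarrow> 'r"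
    unfolding cong_rel_iff[OF m3]
    by (intro conjI equation_cochains[OF that] equation_cross[OF that])
  show "\<exists>s :: face \<Rightarrow> 'r. cohomology_class m (dual \<gamma>) = cohomology_class m (lincombB m s) \<and>
      dual \<gamma> - lincombB m s \<in> cochain.span {l - r | l r. equation m l r}"
    if "\<gamma> \<in> setC m" for \<gamma>
  proof -
    have dual: "(dual \<gamma> :: face \<Rightarrow> 'r) \<in> cochains m 2"
      using that by (intro dual_cochain) (simp add: setC_def)
    obtain g :: "nat \<Rightarrow> nat \<Rightarrow> 'r" where g: "normalised g"
      "dual \<gamma> - lincombB m (restrict (dual \<gamma> - cross m g) (setB m)) = cross m g"
      using reduce_to_B[OF assms dual] by blast
    show ?thesis
      by (intro exI conjI, rule same_class[OF dual g(2)], subst g(2), rule normalised_in_span[OF assms g(1)])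
  qed
qed

end
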